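(* Let $G$ be a connected Lie group acting freely and properly on a manifold $Q$, let $L:TQ\to\mathbb{R}$ be a $G$-invariant Lagrangian (no regularity is assumed), and fix a principal connection on $Q\to Q/G$. Let $(q(t),v(t),p(t))$, $t\in I\subset\mathbb R$, be a curve in $M=TQ\oplus T^*Q$ that is a solution of the implicit Euler-Lagrange equations of $L$, written $(x^i(t),\theta^a(t),v^i(t),\tilde{\mathrm v}^a(t),p_i(t),\tilde{\mathrm p}_a(t))$ in coordinates $(x^i,\theta^a)$ on $Q$ (with $x^i$ coordinates on $Q/G$) and in quasi-velocities and quasi-momenta with respect to the frame $\{X_i,\tilde E_a\}$. Then the $\tilde{\mathrm p}_a$ are constant along the solution, say $\tilde{\mathrm p}_a=\mu_a$ with $\mu=\mu_aE^a\in\mathfrak g^*$, and the curve satisfies the implicit Lagrange-Routh equations $$\tilde{\mathrm v}^a=\tilde{\mathrm u}^a,\qquad \tilde E_a^{\rm V}(R^\mu)=0,\qquad \tilde{\mathrm p}_a=\mu_a,$$ $$v^i=\dot x^i,\qquad X_i^{\rm V}(R^\mu)=p_i,\qquad \dot p_i=X_i^{\rm C}(R^\mu)-\mu_aB^a_{ij}v^j,$$ where $R^\mu(q,v)=L(q,v)-\mu_a\tilde{\mathrm v}^a$ is the generalized Routhian on $TQ$ and $(\dot x^i,\tilde{\mathrm u}^a)$ are the quasi-velocities of $\dot q(t)$.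
   Context: Summation over repeated indices is used. $G$-invariance of $L$ is with respect to the tangent-lifted action on $TQ$. $\{E_a\}$ is a basis of the Lie algebra $\mathfrak g$ with dual basis $\{E^a\}$ of $\mathfrak g^*$, and $\tilde E_a$ is the fundamental vector field of the action on $Q$ associated with $E_a$. $X_i$ is the horizontal lift to $Q$, with respect to the chosen principal connection, of the coordinate field $\partial/\partial x^i$ on $Q/G$. $\{X_i,\tilde E_a\}$ is a local frame on $Q$. The functions $B^a_{ij}$ on $Q$ are defined by $[X_i,X_j]=B^a_{ij}\tilde E_a$. Quasi-velocities $(v^i,\tilde{\mathrm v}^a)$ of $v_q\in T_qQ$ are defined by $v_q=v^iX_i(q)+\tilde{\mathrm v}^a\tilde E_a(q)$; they are regarded as functions on $TQ$. Quasi-momenta of $p_q\in T_q^*Q$ are $p_i=\langle p_q,X_i(q)\rangle$ and $\tilde{\mathrm p}_a=\langle p_q,\tilde E_a(q)\rangle$. For a vector field $X=X^\alpha\,\partial/\partial q^\alpha$ on $Q$, its complete and vertical lifts to $TQ$ (natural coordinates $(q^\alpha,v^\alpha)$) are $X^{\rm C}=X^\beta\frac{\partial}{\partial q^\beta}+\frac{\partial X^\beta}{\partial q^\gamma}v^\gamma\frac{\partial}{\partial v^\beta}$ and $X^{\rm V}=X^\beta\frac{\partial}{\partial v^\beta}$. Functions on $TQ$ are evaluated along $(q(t),v(t))$. Implicit Euler-Lagrange equations. With respect to a frame $\{Z_\alpha\}$ on $Q$, with quasi-velocities ${\mathrm v}^\alpha$ of $v(t)$, quasi-momenta ${\mathrm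 p}_\alpha=\langle p,Z_\alpha\rangle$ of $p(t)$ and quasi-velocities ${\mathrm u}^\alpha$ of $\dot q(t)$, they are ${\mathrm v}^\alpha={\mathrm u}^\alpha$, ${\mathrm p}_\alpha=Z_\alpha^{\rm V}(L)$, $\dot{\mathrm p}_\alpha=Z_\alpha^{\rm C}(L)$. They are the equations obtained from the Hamilton-Pontryagin principle $\delta\int[L(q,v)+\langle p,\dot q-v\rangle]dt=0$ (variations with $q$ fixed at the endpoints, $v,p$ arbitrary); here they are used with $\{Z_\alpha\}=\{X_i,\tilde E_a\}$. *)

theory Defs
  imports "HOL-Analysis.Analysis" "HOL-Algebra.Group_Action"
begin

section \<open>Smooth manifolds\<close>

text \<open>
  For a map on an open subset of a finite-dimensional normed space (the only case in which it is
  used), \<open>Ck_on k\<close> is the usual notion of a \<open>k\<close> times continuously differentiable map.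
\<close>

primrec Ck_on ::
  "nat \<Rightarrow> ('a::real_normed_vector \<Rightarrow> 'b::real_normed_vector) \<Rightarrow> 'a set \<Rightarrow> bool" where
  "Ck_on 0 f S \<longleftrightarrow> continuous_on S f"
| "Ck_on (Suc k) f S \<longleftrightarrow>
     (\<forall>x\<in>S. f differentiable (at x)) \<and> (\<forall>v. Ck_on k (\<lambda>x. frechet_derivative f (at x) v) S)"

definition smooth_on :: "('a::real_normed_vector \<Rightarrow> 'b::real_normed_vector) \<Rightarrow> 'a set \<Rightarrow> bool" where
  "smooth_on f S \<longleftrightarrow> (\<forall>k. Ck_on k f S)"

text \<open>
  Model spaces are finite-dimensional real normed spaces rather than members of the class
  \<open>euclidean_space\<close>, because that class excludes dimension 0: both the Lie group and
  the quotient manifold may be zero-dimensional.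
\<close>

definition is_basis :: "'a::real_vector set \<Rightarrow> bool" where
  "is_basis S \<longleftrightarrow> finite S \<and> independent S \<and> span S = UNIV"

type_synonym ('q, 'e) chart = "'q set \<times> ('q \<Rightarrow> 'e)"

record ('q, 'e) manifold =
  mtop :: "'q topology"
  atlas :: "('q, 'e) chart set"

definition chart_inv :: "('q, 'e) chart \<Rightarrow> 'e \<Rightarrow> 'q" where
  "chart_inv c = inv_into (fst c) (snd c)"

definition is_chart :: "'q topology \<Rightarrow> ('q, 'e::real_normed_vector) chart \<Rightarrow> bool" where
  "is_chart T c \<longleftrightarrow> openin T (fst c) \<and> open (snd c ` fst c) \<and>
     homeomorphic_map (subtopology T (fst c)) (top_of_set (snd c ` fst c)) (snd c)"

text \<open>The atlas is not required to be maximal.\<close>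

definition smooth_manifold :: "('q, 'e::real_normed_vector) manifold \<Rightarrow> bool" where
  "smooth_manifold M \<longleftrightarrow>
     (\<exists>S::'e set. is_basis S) \<and>
     Hausdorff_space (mtop M) \<and> second_countable (mtop M) \<and>
     (\<forall>c\<in>atlas M. is_chart (mtop M) c) \<and>
     (\<Union>c\<in>atlas M. fst c) = topspace (mtop M) \<and>
     (\<forall>c\<in>atlas M. \<forall>d\<in>atlas M. smooth_on (snd d \<circ> chart_inv c) (snd c ` (fst c \<inter> fst d)))"

definition smooth_map ::
  "('q, 'e::real_normed_vector) manifold \<Rightarrow> ('r, 'f::real_normed_vector) manifold \<Rightarrow>
   ('q \<Rightarrow> 'r) \<Rightarrow> bool" where
  "smooth_map M N f \<longleftrightarrow> continuous_map (mtop M) (mtop N) f \<and>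
     (\<forall>c\<in>atlas M. \<forall>d\<in>atlas N.
        smooth_on (snd d \<circ> f \<circ> chart_inv c) (snd c ` {q \<in> fst c. f q \<in> fst d}))"

definition prod_manifold ::
  "('q, 'e) manifold \<Rightarrow> ('r, 'f) manifold \<Rightarrow> ('q \<times> 'r, 'e \<times> 'f) manifold" where
  "prod_manifold M N =
     \<lparr> mtop = prod_topology (mtop M) (mtop N),
       atlas = {(fst c \<times> fst d, map_prod (snd c) (snd d)) | c d. c \<in> atlas M \<and> d \<in> atlas N} \<rparr>"


section \<open>Tangent vectors\<close>

text \<open>
  At every point a reference chart is selected. A tangent vector at \<open>q\<close> is an element of the model
  space: the list of its components in the reference chart at \<open>q\<close>. Its components in any
  other chart around \<open>q\<close> are obtained from the derivative of the transition map. Thus a point of the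
  tangent bundle is a pair \<open>(q, v)\<close>, and a cotangent vector at \<open>q\<close> is a linear functional on the
  model space. The reference charts at nearby points are unrelated, so every smoothness condition
  and every derivative below is formulated in one fixed chart.
\<close>

definition chart_at :: "('q, 'e) manifold \<Rightarrow> 'q \<Rightarrow> ('q, 'e) chart" where
  "chart_at M q = (SOME c. c \<in> atlas M \<and> q \<in> fst c)"

text \<open>Components in the chart \<open>c\<close> of the tangent vector \<open>v\<close> at \<open>q\<close>, and conversely the tangent
  vector at \<open>q\<close> with components \<open>w\<close> in the chart \<open>c\<close>.\<close>

definition components ::
  "('q, 'e::real_normed_vector) manifold \<Rightarrow> ('q, 'e) chart \<Rightarrow> 'q \<Rightarrow> 'e \<Rightarrow> 'e" where
  "components M c q v =
     frechet_derivative (snd c \<circ> chart_inv (chart_at M q)) (at (snd (chart_at M q) q)) v"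

definition tangent_vector ::
  "('q, 'e::real_normed_vector) manifold \<Rightarrow> ('q, 'e) chart \<Rightarrow> 'q \<Rightarrow> 'e \<Rightarrow> 'e" where
  "tangent_vector M c q w =
     frechet_derivative (snd (chart_at M q) \<circ> chart_inv c) (at (snd c q)) w"

definition tangent_map ::
  "('q, 'e::real_normed_vector) manifold \<Rightarrow> ('r, 'f::real_normed_vector) manifold \<Rightarrow>
   ('q \<Rightarrow> 'r) \<Rightarrow> 'q \<Rightarrow> 'e \<Rightarrow> 'f" where
  "tangent_map M N f q v =
     frechet_derivative (snd (chart_at N (f q)) \<circ> f \<circ> chart_inv (chart_at M q))
       (at (snd (chart_at M q) q)) v"

text \<open>Function on the tangent bundle, written in the natural coordinates induced by the chart \<open>c\<close>.\<close>

definition in_natural_coords ::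
  "('q, 'e::real_normed_vector) manifold \<Rightarrow> ('q, 'e) chart \<Rightarrow> ('q \<times> 'e \<Rightarrow> 'f) \<Rightarrow> 'e \<times> 'e \<Rightarrow> 'f" where
  "in_natural_coords M c f =
     (\<lambda>(x, w). f (chart_inv c x, tangent_vector M c (chart_inv c x) w))"

definition smooth_on_tangent_bundle ::
  "('q, 'e::real_normed_vector) manifold \<Rightarrow> ('q \<times> 'e \<Rightarrow> 'f::real_normed_vector) \<Rightarrow> bool" where
  "smooth_on_tangent_bundle M f \<longleftrightarrow>
     (\<forall>c\<in>atlas M. smooth_on (in_natural_coords M c f) ((snd c ` fst c) \<times> UNIV))"

text \<open>Component functions of a vector field in the chart \<open>c\<close>.\<close>

definition vf_in ::
  "('q, 'e::real_normed_vector) manifold \<Rightarrow> ('q, 'e) chart \<Rightarrow> ('q \<Rightarrow> 'e) \<Rightarrow> 'e \<Rightarrow> 'e" where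
  "vf_in M c X x = components M c (chart_inv c x) (X (chart_inv c x))"

text \<open>
  Lie bracket, complete lift and vertical lift, computed in the reference chart at the base point
  (the results do not depend on the chart). The sums over coordinate indices in the classical
  formulas are written as directional derivatives: in natural coordinates \<open>(x, w)\<close>, the complete
  lift of \<open>X\<close> is the derivation in the direction \<open>(X(x), DX(x) w)\<close>, and the vertical lift of \<open>X\<close> is
  the derivation in the direction \<open>(0, X(x))\<close>.
\<close>

definition lie_bracket ::
  "('q, 'e::real_normed_vector) manifold \<Rightarrow> ('q \<Rightarrow> 'e) \<Rightarrow> ('q \<Rightarrow> 'e) \<Rightarrow> 'q \<Rightarrow> 'e" where
  "lie_bracket M X Y q =
     (let c = chart_at M q; x = snd c q in
        frechet_derivative (vf_in M c Y) (at x) (vf_in M c X x)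
        - frechet_derivative (vf_in M c X) (at x) (vf_in M c Y x))"

definition complete_lift ::
  "('q, 'e::real_normed_vector) manifold \<Rightarrow> ('q \<Rightarrow> 'e) \<Rightarrow> ('q \<times> 'e \<Rightarrow> real) \<Rightarrow> 'q \<times> 'e \<Rightarrow> real" where
  "complete_lift M X f =
     (\<lambda>(q, v). let c = chart_at M q; x = snd c q; w = components M c q v in
        frechet_derivative (in_natural_coords M c f) (at (x, w))
          (vf_in M c X x, frechet_derivative (vf_in M c X) (at x) w))"

definition vertical_lift ::
  "('q, 'e::real_normed_vector) manifold \<Rightarrow> ('q \<Rightarrow> 'e) \<Rightarrow> ('q \<times> 'e \<Rightarrow> real) \<Rightarrow> 'q \<times> 'e \<Rightarrow> real" where
  "vertical_lift M X f =
     (\<lambda>(q, v). let c = chart_at M q; x = snd c q; w = components M c q v in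
        frechet_derivative (in_natural_coords M c f) (at (x, w)) (0, vf_in M c X x))"

definition differentiable_curve ::
  "('q, 'e::real_normed_vector) manifold \<Rightarrow> real set \<Rightarrow> (real \<Rightarrow> 'q) \<Rightarrow> bool" where
  "differentiable_curve M I q \<longleftrightarrow> continuous_map (top_of_set I) (mtop M) q \<and>
     (\<forall>t\<in>I. \<forall>c\<in>atlas M. q t \<in> fst c \<longrightarrow> (snd c \<circ> q) differentiable (at t within I))"

definition velocity ::
  "('q, 'e::real_normed_vector) manifold \<Rightarrow> real set \<Rightarrow> (real \<Rightarrow> 'q) \<Rightarrow> real \<Rightarrow> 'e" where
  "velocity M I q t = vector_derivative (snd (chart_at M (q t)) \<circ> q) (at t within I)"


section \<open>Lie groups, actions, quotients and principal connections\<close>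

definition lie_group :: "('g, 'm) monoid_scheme \<Rightarrow> ('g, 'l::real_normed_vector) manifold \<Rightarrow> bool" where
  "lie_group G GM \<longleftrightarrow> Group.group G \<and> smooth_manifold GM \<and> carrier G = topspace (mtop GM) \<and>
     smooth_map (prod_manifold GM GM) GM (\<lambda>(g, h). g \<otimes>\<^bsub>G\<^esub> h) \<and>
     smooth_map GM GM (\<lambda>g. inv\<^bsub>G\<^esub> g)"

definition smooth_action ::
  "('g, 'm) monoid_scheme \<Rightarrow> ('g, 'l::real_normed_vector) manifold \<Rightarrow>
   ('q, 'e::real_normed_vector) manifold \<Rightarrow> ('g \<Rightarrow> 'q \<Rightarrow> 'q) \<Rightarrow> bool" where
  "smooth_action G GM Q \<phi> \<longleftrightarrow> group_action G (topspace (mtop Q)) \<phi> \<and>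
     smooth_map (prod_manifold GM Q) Q (\<lambda>(g, q). \<phi> g q)"

definition free_action ::
  "('g, 'm) monoid_scheme \<Rightarrow> ('q, 'e) manifold \<Rightarrow> ('g \<Rightarrow> 'q \<Rightarrow> 'q) \<Rightarrow> bool" where
  "free_action G Q \<phi> \<longleftrightarrow> (\<forall>q\<in>topspace (mtop Q). stabilizer G \<phi> q = {\<one>\<^bsub>G\<^esub>})"

definition proper_action ::
  "('g, 'l) manifold \<Rightarrow> ('q, 'e) manifold \<Rightarrow> ('g \<Rightarrow> 'q \<Rightarrow> 'q) \<Rightarrow> bool" where
  "proper_action GM Q \<phi> \<longleftrightarrow>
     proper_map (prod_topology (mtop GM) (mtop Q)) (prod_topology (mtop Q) (mtop Q))
       (\<lambda>(g, q). (\<phi> g q, q))"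

text \<open>The quotient manifold \<open>Q/G\<close>: the set of orbits with the (unique) manifold structure for which
  the projection is a smooth submersion.\<close>

definition quotient_manifold ::
  "('g, 'm) monoid_scheme \<Rightarrow> ('q, 'e::real_normed_vector) manifold \<Rightarrow> ('g \<Rightarrow> 'q \<Rightarrow> 'q) \<Rightarrow>
   ('q set, 'b::real_normed_vector) manifold \<Rightarrow> bool" where
  "quotient_manifold G Q \<phi> QG \<longleftrightarrow> smooth_manifold QG \<and>
     topspace (mtop QG) = orbits G (topspace (mtop Q)) \<phi> \<and>
     smooth_map Q QG (orbit G \<phi>) \<and>
     (\<forall>q\<in>topspace (mtop Q). range (tangent_map Q QG (orbit G \<phi>) q) = UNIV)"

text \<open>The Lie algebra of \<open>G\<close> is, as a vector space, the tangent space at the identity, i.e. the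
  model space of \<open>GM\<close>. The fundamental vector field of \<open>\<xi>\<close> is the derivative at the identity of the
  orbit map in the direction \<open>\<xi>\<close>.\<close>

definition fundamental_field ::
  "('g, 'm) monoid_scheme \<Rightarrow> ('g, 'l::real_normed_vector) manifold \<Rightarrow>
   ('q, 'e::real_normed_vector) manifold \<Rightarrow> ('g \<Rightarrow> 'q \<Rightarrow> 'q) \<Rightarrow> 'l \<Rightarrow> 'q \<Rightarrow> 'e" where
  "fundamental_field G GM Q \<phi> \<xi> q = tangent_map GM Q (\<lambda>g. \<phi> g q) \<one>\<^bsub>G\<^esub> \<xi>"

definition Ad ::
  "('g, 'm) monoid_scheme \<Rightarrow> ('g, 'l::real_normed_vector) manifold \<Rightarrow> 'g \<Rightarrow> 'l \<Rightarrow> 'l" where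
  "Ad G GM g = tangent_map GM GM (\<lambda>h. g \<otimes>\<^bsub>G\<^esub> h \<otimes>\<^bsub>G\<^esub> inv\<^bsub>G\<^esub> g) \<one>\<^bsub>G\<^esub>"

text \<open>A principal connection is given by its connection form, regarded as a Lie algebra valued
  function on the tangent bundle.\<close>

definition principal_connection ::
  "('g, 'm) monoid_scheme \<Rightarrow> ('g, 'l::real_normed_vector) manifold \<Rightarrow>
   ('q, 'e::real_normed_vector) manifold \<Rightarrow> ('g \<Rightarrow> 'q \<Rightarrow> 'q) \<Rightarrow> ('q \<times> 'e \<Rightarrow> 'l) \<Rightarrow> bool" where
  "principal_connection G GM Q \<phi> \<A> \<longleftrightarrow>
     smooth_on_tangent_bundle Q \<A> \<and>
     (\<forall>q\<in>topspace (mtop Q).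
        linear (\<lambda>v. \<A> (q, v)) \<and>
        (\<forall>\<xi>. \<A> (q, fundamental_field G GM Q \<phi> \<xi> q) = \<xi>) \<and>
        (\<forall>g\<in>carrier G. \<forall>v. \<A> (\<phi> g q, tangent_map Q Q (\<phi> g) q v) = Ad G GM g (\<A> (q, v))))"

definition invariant_lagrangian ::
  "('g, 'm) monoid_scheme \<Rightarrow> ('q, 'e::real_normed_vector) manifold \<Rightarrow> ('g \<Rightarrow> 'q \<Rightarrow> 'q) \<Rightarrow>
   ('q \<times> 'e \<Rightarrow> real) \<Rightarrow> bool" where
  "invariant_lagrangian G Q \<phi> L \<longleftrightarrow>
     (\<forall>g\<in>carrier G. \<forall>q\<in>topspace (mtop Q). \<forall>v. L (\<phi> g q, tangent_map Q Q (\<phi> g) q v) = L (q, v))"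

definition horizontal_lift ::
  "('g, 'm) monoid_scheme \<Rightarrow> ('q, 'e::real_normed_vector) manifold \<Rightarrow> ('g \<Rightarrow> 'q \<Rightarrow> 'q) \<Rightarrow>
   ('q set, 'b::real_normed_vector) manifold \<Rightarrow> ('q \<times> 'e \<Rightarrow> 'l::real_normed_vector) \<Rightarrow>
   ('q set \<Rightarrow> 'b) \<Rightarrow> 'q \<Rightarrow> 'e" where
  "horizontal_lift G Q \<phi> QG \<A> Y q =
     (THE u. tangent_map Q QG (orbit G \<phi>) q u = Y (orbit G \<phi> q) \<and> \<A> (q, u) = 0)"

text \<open>
  A basis of the model space of \<open>Q/G\<close> turns a chart \<open>\<kappa>\<close> into coordinates \<open>x\<^sup>i\<close>. Bases are sets of
  vectors, and the basis vectors themselves serve as indices: \<open>i\<close> is the basis vector of the model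
  space such that \<open>\<partial>/\<partial>x\<^sup>i\<close> has components \<open>i\<close> in \<open>\<kappa>\<close>, and \<open>a\<close> is the Lie algebra element \<open>E\<^sub>a\<close>.
  In the frame \<open>{X\<^sub>i, E\<^sub>a}\<close> on the domain over \<open>\<kappa>\<close>, \<open>Inl i\<close> is the index of \<open>X\<^sub>i\<close> and \<open>Inr a\<close> that of
  the fundamental vector field of \<open>E\<^sub>a\<close>.
\<close>

definition adapted_frame ::
  "('g, 'm) monoid_scheme \<Rightarrow> ('g, 'l::real_normed_vector) manifold \<Rightarrow>
   ('q, 'e::real_normed_vector) manifold \<Rightarrow> ('g \<Rightarrow> 'q \<Rightarrow> 'q) \<Rightarrow>
   ('q set, 'b::real_normed_vector) manifold \<Rightarrow> ('q \<times> 'e \<Rightarrow> 'l) \<Rightarrow> ('q set, 'b) chart \<Rightarrow>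
   'b + 'l \<Rightarrow> 'q \<Rightarrow> 'e" where
  "adapted_frame G GM Q \<phi> QG \<A> \<kappa> =
     case_sum (\<lambda>i. horizontal_lift G Q \<phi> QG \<A> (\<lambda>y. tangent_vector QG \<kappa> y i))
              (fundamental_field G GM Q \<phi>)"


section \<open>Implicit Euler--Lagrange and Lagrange--Routh equations\<close>

text \<open>Coefficients of \<open>u\<close> with respect to the linearly independent family \<open>(w \<alpha>)\<close>, \<open>\<alpha> \<in> J\<close>.\<close>

definition coefficients :: "'i set \<Rightarrow> ('i \<Rightarrow> 'e::real_vector) \<Rightarrow> 'e \<Rightarrow> 'i \<Rightarrow> real" where
  "coefficients J w u = (THE k. (\<forall>\<alpha>. \<alpha> \<notin> J \<longrightarrow> k \<alpha> = 0) \<and> u = (\<Sum>\<alpha>\<in>J. k \<alpha> *\<^sub>R w \<alpha>))"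

definition quasi_velocity ::
  "'i set \<Rightarrow> ('i \<Rightarrow> 'q \<Rightarrow> 'e::real_vector) \<Rightarrow> 'i \<Rightarrow> 'q \<times> 'e \<Rightarrow> real" where
  "quasi_velocity J Z \<alpha> = (\<lambda>(q, v). coefficients J (\<lambda>\<beta>. Z \<beta> q) v \<alpha>)"

definition quasi_momentum ::
  "('i \<Rightarrow> 'q \<Rightarrow> 'e) \<Rightarrow> 'i \<Rightarrow> 'q \<Rightarrow> ('e \<Rightarrow> real) \<Rightarrow> real" where
  "quasi_momentum Z \<alpha> q p = p (Z \<alpha> q)"

text \<open>The implicit Euler--Lagrange equations at time \<open>t\<close> with respect to a frame \<open>Z\<close> with index set
  \<open>J\<close>, defined around \<open>q t\<close>.\<close>

definition implicit_euler_lagrange ::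
  "('q, 'e::real_normed_vector) manifold \<Rightarrow> ('q \<times> 'e \<Rightarrow> real) \<Rightarrow> 'i set \<Rightarrow> ('i \<Rightarrow> 'q \<Rightarrow> 'e) \<Rightarrow>
   real set \<Rightarrow> (real \<Rightarrow> 'q) \<Rightarrow> (real \<Rightarrow> 'e) \<Rightarrow> (real \<Rightarrow> 'e \<Rightarrow> real) \<Rightarrow> real \<Rightarrow> bool" where
  "implicit_euler_lagrange M L J Z I q v p t \<longleftrightarrow>
     (\<forall>\<alpha>\<in>J.
        quasi_velocity J Z \<alpha> (q t, v t) = quasi_velocity J Z \<alpha> (q t, velocity M I q t) \<and>
        quasi_momentum Z \<alpha> (q t) (p t) = vertical_lift M (Z \<alpha>) L (q t, v t) \<and>
        ((\<lambda>s. quasi_momentum Z \<alpha> (q s) (p s)) has_real_derivative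
           complete_lift M (Z \<alpha>) L (q t, v t)) (at t within I))"

text \<open>The curvature coefficients \<open>B\<^sup>a\<^sub>i\<^sub>j\<close>, defined by \<open>[X\<^sub>i, X\<^sub>j] = B\<^sup>a\<^sub>i\<^sub>j E\<^sub>a\<close>; \<open>EE\<close> is the basis of the
  Lie algebra.\<close>

definition curvature_coeff ::
  "('q, 'e::real_normed_vector) manifold \<Rightarrow> 'l set \<Rightarrow> ('b + 'l \<Rightarrow> 'q \<Rightarrow> 'e) \<Rightarrow>
   'l \<Rightarrow> 'b \<Rightarrow> 'b \<Rightarrow> 'q \<Rightarrow> real" where
  "curvature_coeff M EE Z a i j q =
     coefficients EE (\<lambda>b. Z (Inr b) q) (lie_bracket M (Z (Inl i)) (Z (Inl j)) q) a"

definition routhian ::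
  "'b set \<Rightarrow> 'l set \<Rightarrow> ('b + 'l \<Rightarrow> 'q \<Rightarrow> 'e::real_normed_vector) \<Rightarrow> ('q \<times> 'e \<Rightarrow> real) \<Rightarrow>
   ('l \<Rightarrow> real) \<Rightarrow> 'q \<times> 'e \<Rightarrow> real" where
  "routhian BB EE Z L \<mu> =
     (\<lambda>(q, v). L (q, v) - (\<Sum>a\<in>EE. \<mu> a * quasi_velocity (BB <+> EE) Z (Inr a) (q, v)))"

text \<open>The implicit Lagrange--Routh equations at time \<open>t\<close>; \<open>x i\<close> is the coordinate function \<open>x\<^sup>i\<close>,
  pulled back to \<open>Q\<close>. Both readings of its time derivative, as a quasi-velocity of the
  curve and as the derivative of \<open>x\<^sup>i\<close> along the curve, are recorded.\<close>

definition implicit_lagrange_routh ::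
  "('q, 'e::real_normed_vector) manifold \<Rightarrow> ('q \<times> 'e \<Rightarrow> real) \<Rightarrow> 'b set \<Rightarrow> 'l set \<Rightarrow>
   ('b + 'l \<Rightarrow> 'q \<Rightarrow> 'e) \<Rightarrow> ('b \<Rightarrow> 'q \<Rightarrow> real) \<Rightarrow> ('l \<Rightarrow> real) \<Rightarrow>
   real set \<Rightarrow> (real \<Rightarrow> 'q) \<Rightarrow> (real \<Rightarrow> 'e) \<Rightarrow> (real \<Rightarrow> 'e \<Rightarrow> real) \<Rightarrow> real \<Rightarrow> bool" where
  "implicit_lagrange_routh M L BB EE Z x \<mu> I q v p t \<longleftrightarrow>
     (let J = BB <+> EE; R = routhian BB EE Z L \<mu> in
     (\<forall>a\<in>EE.
        quasi_velocity J Z (Inr a) (q t, v t)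
          = quasi_velocity J Z (Inr a) (q t, velocity M I q t) \<and>
        vertical_lift M (Z (Inr a)) R (q t, v t) = 0 \<and>
        quasi_momentum Z (Inr a) (q t) (p t) = \<mu> a) \<and>
     (\<forall>i\<in>BB.
        quasi_velocity J Z (Inl i) (q t, v t)
          = quasi_velocity J Z (Inl i) (q t, velocity M I q t) \<and>
        ((\<lambda>s. x i (q s)) has_real_derivative quasi_velocity J Z (Inl i) (q t, v t))
          (at t within I) \<and>
        vertical_lift M (Z (Inl i)) R (q t, v t) = quasi_momentum Z (Inl i) (q t) (p t) \<and>
        ((\<lambda>s. quasi_momentum Z (Inl i) (q s) (p s)) has_real_derivative
           complete_lift M (Z (Inl i)) R (q t, v t)
           - (\<Sum>a\<in>EE. \<Sum>j\<in>BB. \<mu> a * curvature_coeff M EE Z a i j (q t)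
                * quasi_velocity J Z (Inl j) (q t, v t))) (at t within I)))"

end

(* The quasi-velocities along the fundamental fields are the components of the connection form A,
   so the Routhian is L - <mu, A>. The complete lift of a fundamental field generates the lifted
   action; hence it annihilates L, which makes the momenta constant, and it kills A on horizontal
   vectors by equivariance. Since A is linear on the fibres, its vertical derivatives are its values,
   and X_i^C(A)(Y) = X_i(A(Y)) - A([X_i, Y]). For Y with constant coefficients in the frame the first
   term vanishes, the brackets with fundamental fields do not contribute, and what remains of the
   second is the curvature term.

   That the X_i and the fundamental fields form a frame needs ker(T pi) to be vertical: a fibre of pi
   is an orbit, the image of countably many charts of G, and would be negligible in the fibre if
   dim G were smaller than dim Q - dim(Q/G). *)

theory Submission
  imports Defs
begin

section \<open>Calculus in finite-dimensional normed spaces\<close>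

text \<open>Two features of the setting shape the work. A tangent vector is stored by its components
  in a reference chart that may jump from point to point, so nothing can be differentiated before it
  is rewritten in one chart held fixed on a neighbourhood. And the horizontal fields are given
  pointwise by a definite description, so even their differentiability, without which [X_i, X_j]
  carries no information, has to be derived: in a chart they solve a linear system with
  differentiable coefficients, whose invertibility is exactly the frame property. Equality of mixed
  partial derivatives is used twice: for the action, where it turns the generator of the lifted
  action into a complete lift, and for the projection, where it makes [X_i, X_j] vertical.
  Equivariance enters at horizontal vectors, where Ad_g 0 = 0, so no structure constants of the Lie
  algebra appear. The momentum value is a linear functional on the whole Lie algebra, read off from
  \<open>p\<close> at one time; it can then be applied to the vector-valued form itself and to
  brackets before any basis is chosen.\<close>

abbreviation fd :: "('a::real_normed_vector \<Rightarrow> 'b::real_normed_vector) \<Rightarrow> 'a \<Rightarrow> 'a \<Rightarrow> 'b" where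
  "fd f x \<equiv> frechet_derivative f (at x)"

lemma fd_eqI: "(f has_derivative f') (at x) \<Longrightarrow> fd f x = f'"
  by (metis frechet_derivative_at)

lemma has_derivative_fd: "f differentiable (at x) \<Longrightarrow> (f has_derivative fd f x) (at x)"
  by (simp add: frechet_derivative_works)

text \<open>The relation \<open>has_derivative\<close> at x is the same for both functions, so the
  choice inside \<open>frechet_derivative\<close> agrees even where no derivative exists; hence no
  differentiability is assumed.\<close>

lemma fd_cong_open:
  assumes "open S" "x \<in> S" "\<And>y. y \<in> S \<Longrightarrow> f y = g y"
  shows "fd f x = fd g x"
proof -
  have "(f has_derivative d) (at x) \<longleftrightarrow> (g has_derivative d) (at x)" for d
    using has_derivative_transform_within_open[of f d x UNIV S g]
      has_derivative_transform_within_open[of g d x UNIV S f] assms by auto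
  then show ?thesis by (simp add: frechet_derivative_def)
qed

lemma differentiable_cong_open:
  assumes "f differentiable (at x)" "open S" "x \<in> S" "\<And>y. y \<in> S \<Longrightarrow> f y = g y"
  shows "g differentiable (at x)"
  using assms has_derivative_transform_within_open[of f _ x UNIV S g]
  unfolding differentiable_def by blast

lemma Ck_on_cong_open:
  assumes "open S" "\<And>y. y \<in> S \<Longrightarrow> f y = g y" "Ck_on k f S"
  shows "Ck_on k g S"
  using assms(2,3)
proof (induction k arbitrary: f g)
  case 0
  then show ?case by (simp cong: continuous_on_cong)
next
  case (Suc k)
  have "Ck_on k (\<lambda>x. fd g x v) S" for v
  proof (rule Suc.IH)
    show "Ck_on k (\<lambda>x. fd f x v) S" using Suc.prems by simp
    show "fd f y v = fd g y v" if "y \<in> S" for y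
      using fd_cong_open[OF assms(1) that, of f g] Suc.prems(1) by simp
  qed
  moreover have "g differentiable (at x)" if "x \<in> S" for x
    using differentiable_cong_open[OF _ assms(1) that Suc.prems(1)] Suc.prems(2) that by simp
  ultimately show ?case by simp
qed

lemma smooth_on_cong_open:
  assumes "smooth_on f S" "open S" "\<And>y. y \<in> S \<Longrightarrow> f y = g y"
  shows "smooth_on g S"
  using assms Ck_on_cong_open unfolding smooth_on_def by blast

lemma smooth_on_differentiable:
  assumes "smooth_on f S" "x \<in> S" shows "f differentiable (at x)"
proof -
  have "Ck_on (Suc 0) f S" using assms unfolding smooth_on_def by blast
  then show ?thesis using assms(2) by simp
qed

lemma smooth_on_fd:
  assumes "smooth_on f S" shows "smooth_on (\<lambda>x. fd f x v) S"
  unfolding smooth_on_def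
proof
  fix k
  have "Ck_on (Suc k) f S" using assms unfolding smooth_on_def by blast
  then show "Ck_on k (\<lambda>x. fd f x v) S" by simp
qed

section \<open>Symmetry of mixed second derivatives\<close>

text \<open>Mean value inequality along v for the increment of f in direction s w, with the expected
  bilinear term subtracted. What remains of the derivative is o(s), because
  \<open>\<lambda>y. fd f y v\<close> is differentiable at the single point x; continuity of second
  derivatives does not enter.\<close>

lemma second_difference_estimate:
  fixes f :: "'a::real_normed_vector \<Rightarrow> 'b::real_normed_vector"
  assumes S: "open S" "x \<in> S" and f: "\<And>y. y \<in> S \<Longrightarrow> f differentiable (at y)"
    and fv: "(\<lambda>y. fd f y v) differentiable (at x)" and e: "e > 0"
  shows "\<forall>\<^sub>F s in at_right 0.
    norm (f (x + s *\<^sub>R v + s *\<^sub>R w) - f (x + s *\<^sub>R v) - f (x + s *\<^sub>R w) + f x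
      - s^2 *\<^sub>R fd (\<lambda>y. fd f y v) x w) \<le> e * s^2"
proof -
  define G where "G = (\<lambda>y. fd f y v)"
  define G' where "G' = fd G x"
  have G': "(G has_derivative G') (at x)"
    using fv unfolding G_def G'_def by (rule has_derivative_fd)
  then interpret G': bounded_linear G' by (rule has_derivative_bounded_linear)
  \<comment> \<open>Two error terms, each at most e / N * s * (norm v + norm w), must add up to at
    most e * s; the summand 1 keeps N positive when v = w = 0.\<close>
  define N where "N = 2 * norm v + 2 * norm w + 1"
  have N: "N > 0" by (simp add: N_def add_nonneg_pos)
  obtain d where d: "d > 0" "\<And>y. norm (y - x) < d \<Longrightarrow> norm (G y - G x - G' (y - x)) \<le> e / N * norm (y - x)"
    using G' e N unfolding has_derivative_at_alt by (metis divide_pos_pos)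
  obtain r where r: "r > 0" "ball x r \<subseteq> S" using S open_contains_ball by blast
  \<comment> \<open>For s below m, all points x + t v + u w with 0 \<le> t, u \<le> s stay in S and
    within distance d of x.\<close>
  define m where "m = min d r / N"
  have m: "m > 0" using d(1) r(1) N by (simp add: m_def)
  have main: "norm (f (x + s *\<^sub>R v + s *\<^sub>R w) - f (x + s *\<^sub>R v) - f (x + s *\<^sub>R w) + f x
      - s^2 *\<^sub>R G' w) \<le> e * s^2" if s: "0 < s" "s < m" for s
  proof -
    have sN: "s * N < min d r" using s N by (simp add: m_def pos_less_divide_eq)
    define h where "h = (\<lambda>t::real. f (x + t *\<^sub>R v + s *\<^sub>R w) - f (x + t *\<^sub>R v) - (t * s) *\<^sub>R G' w)"
    define h' where "h' = (\<lambda>t k::real. k *\<^sub>R (G (x + t *\<^sub>R v + s *\<^sub>R w) - G (x + t *\<^sub>R v) - s *\<^sub>R G' w))"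
    have nb: "norm (t *\<^sub>R v + u *\<^sub>R w) \<le> s * (norm v + norm w)" if "0 \<le> t" "t \<le> s" "0 \<le> u" "u \<le> s" for t u
    proof -
      have "norm (t *\<^sub>R v + u *\<^sub>R w) \<le> t * norm v + u * norm w"
        using norm_triangle_ineq[of "t *\<^sub>R v" "u *\<^sub>R w"] that by simp
      also have "\<dots> \<le> s * norm v + s * norm w" using that by (intro add_mono mult_right_mono) auto
      finally show ?thesis by (simp add: algebra_simps)
    qed
    have le: "s * (norm v + norm w) < min d r"
      by (rule order_le_less_trans[OF _ sN]) (use s in \<open>auto simp: N_def intro!: mult_left_mono\<close>)
    have small: "norm (t *\<^sub>R v + u *\<^sub>R w) < d" "x + t *\<^sub>R v + u *\<^sub>R w \<in> S"
      if "0 \<le> t" "t \<le> s" "0 \<le> u" "u \<le> s" for t u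
    proof -
      show "norm (t *\<^sub>R v + u *\<^sub>R w) < d" using nb[OF that] le by linarith
      have "dist x (x + t *\<^sub>R v + u *\<^sub>R w) = norm (t *\<^sub>R v + u *\<^sub>R w)"
        by (simp add: dist_norm add.assoc del: minus_add_distrib)
      then have "x + t *\<^sub>R v + u *\<^sub>R w \<in> ball x r" using nb[OF that] le by simp
      then show "x + t *\<^sub>R v + u *\<^sub>R w \<in> S" using r(2) by blast
    qed
    have est: "norm (G (x + t *\<^sub>R v + u *\<^sub>R w) - G x - G' (t *\<^sub>R v + u *\<^sub>R w)) \<le> e / N * (s * (norm v + norm w))"
      if "0 \<le> t" "t \<le> s" "0 \<le> u" "u \<le> s" for t u
    proof -
      have "norm (G (x + t *\<^sub>R v + u *\<^sub>R w) - G x - G' (t *\<^sub>R v + u *\<^sub>R w)) \<le> e / N * norm (t *\<^sub>R v + u *\<^sub>R w)"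
        using d(2)[of "x + t *\<^sub>R v + u *\<^sub>R w"] small(1)[OF that] by (simp add: add.assoc)
      also have "\<dots> \<le> e / N * (s * (norm v + norm w))"
        using nb[OF that] e N by (intro mult_left_mono) auto
      finally show ?thesis .
    qed
    have "(h has_derivative h' t) (at t within {0..s})" if t: "t \<in> {0..s}" for t
    proof -
      have 1: "((\<lambda>t. f (x + t *\<^sub>R v + u *\<^sub>R w)) has_derivative (\<lambda>k. k *\<^sub>R G (x + t *\<^sub>R v + u *\<^sub>R w))) (at t within {0..s})"
        if u: "0 \<le> u" "u \<le> s" for u
      proof -
        have D: "f differentiable (at (x + t *\<^sub>R v + u *\<^sub>R w))"
          using f small(2) t u by simp
        have "((\<lambda>t. f (x + t *\<^sub>R v + u *\<^sub>R w)) has_derivative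
            (\<lambda>k. fd f (x + t *\<^sub>R v + u *\<^sub>R w) (k *\<^sub>R v))) (at t within {0..s})"
          by (rule has_derivative_compose[where f = "\<lambda>t. x + t *\<^sub>R v + u *\<^sub>R w" and g = f,
                OF _ has_derivative_fd[OF D]])
             (auto intro!: derivative_eq_intros)
        then show ?thesis
          using linear_scale[OF linear_frechet_derivative[OF D]] by (simp add: G_def)
      qed
      have 2: "((\<lambda>t. (t * s) *\<^sub>R G' w) has_derivative (\<lambda>k. (k * s) *\<^sub>R G' w)) (at t within {0..s})"
        by (auto intro!: derivative_eq_intros)
      have 3: "((\<lambda>t. f (x + t *\<^sub>R v)) has_derivative (\<lambda>k. k *\<^sub>R G (x + t *\<^sub>R v))) (at t within {0..s})"
        using 1[of 0] s by simp
      show ?thesis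
        using has_derivative_diff[OF has_derivative_diff[OF 1[of s] 3] 2] s
        by (simp add: h_def h'_def scaleR_diff_right)
    qed
    moreover have "onorm (h' t) \<le> e * s" if t: "t \<in> {0..s}" for t
    proof (rule onorm_le)
      fix k
      \<comment> \<open>Both values of G are compared with the linearisation at x; the term s G' w
        is the difference of the two linear parts.\<close>
      have "norm (G (x + t *\<^sub>R v + s *\<^sub>R w) - G (x + t *\<^sub>R v) - s *\<^sub>R G' w)
        = norm ((G (x + t *\<^sub>R v + s *\<^sub>R w) - G x - G' (t *\<^sub>R v + s *\<^sub>R w))
              - (G (x + t *\<^sub>R v + 0 *\<^sub>R w) - G x - G' (t *\<^sub>R v + 0 *\<^sub>R w)))"
        by (simp add: G'.add G'.scaleR algebra_simps)
      also have "\<dots> \<le> e / N * (s * (norm v + norm w)) + e / N * (s * (norm v + norm w))"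
        by (rule order_trans[OF norm_triangle_ineq4 add_mono[OF est[of t s] est[of t 0]]]) (use t s in auto)
      also have "\<dots> = e * s * ((2 * norm v + 2 * norm w) / N)" by (simp add: field_simps)
      also have "\<dots> \<le> e * s * 1"
        using e s N by (intro mult_left_mono) (auto simp: N_def)
      finally have "norm (G (x + t *\<^sub>R v + s *\<^sub>R w) - G (x + t *\<^sub>R v) - s *\<^sub>R G' w) \<le> e * s" by simp
      then show "norm (h' t k) \<le> e * s * norm k"
        unfolding h'_def by (simp add: mult.commute[of "\<bar>k\<bar>"] mult_right_mono)
    qed
    ultimately have "norm (h s - h 0) \<le> e * s * norm (s - 0)"
      using s by (intro differentiable_bound[of "{0..s}"]) auto
    then show ?thesis using s by (simp add: h_def power2_eq_square algebra_simps)
  qed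
  show ?thesis
    unfolding eventually_at_right_field
    by (rule exI[of _ m]) (use m main in \<open>auto simp: G_def G'_def\<close>)
qed

text \<open>The second difference does not change when v and w are exchanged, and divided by s^2 it
  tends to either mixed derivative.\<close>

lemma fd_symmetric:
  fixes f :: "'a::real_normed_vector \<Rightarrow> 'b::real_normed_vector"
  assumes S: "open S" "x \<in> S" and f: "\<And>y. y \<in> S \<Longrightarrow> f differentiable (at y)"
    and v: "(\<lambda>y. fd f y v) differentiable (at x)" and w: "(\<lambda>y. fd f y w) differentiable (at x)"
  shows "fd (\<lambda>y. fd f y v) x w = fd (\<lambda>y. fd f y w) x v"
proof (rule ccontr)
  define A where "A = fd (\<lambda>y. fd f y v) x w"
  define B where "B = fd (\<lambda>y. fd f y w) x v"
  assume "\<not> ?thesis"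
  then have "norm (A - B) > 0" by (simp add: A_def B_def)
  \<comment> \<open>The two errors sum to 2 e, strictly less than 3 e = norm (A - B).\<close>
  define e where "e = norm (A - B) / 3"
  have e: "e > 0" using \<open>norm (A - B) > 0\<close> by (simp add: e_def)
  have "\<forall>\<^sub>F s::real in at_right 0. s > 0" by (simp add: eventually_at_right_less)
  moreover have "\<forall>\<^sub>F s in at_right 0. norm (f (x + s *\<^sub>R v + s *\<^sub>R w) - f (x + s *\<^sub>R v)
      - f (x + s *\<^sub>R w) + f x - s^2 *\<^sub>R A) \<le> e * s^2"
    unfolding A_def by (rule second_difference_estimate[OF S _ v e]) (rule f)
  moreover have "\<forall>\<^sub>F s in at_right 0. norm (f (x + s *\<^sub>R w + s *\<^sub>R v) - f (x + s *\<^sub>R w)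
      - f (x + s *\<^sub>R v) + f x - s^2 *\<^sub>R B) \<le> e * s^2"
    unfolding B_def by (rule second_difference_estimate[OF S _ w e]) (rule f)
  ultimately have "\<forall>\<^sub>F s::real in at_right 0. norm (A - B) \<le> 2 * e"
  proof eventually_elim
    case (elim s)
    define \<Delta> where "\<Delta> = f (x + s *\<^sub>R v + s *\<^sub>R w) - f (x + s *\<^sub>R v) - f (x + s *\<^sub>R w) + f x"
    have 1: "norm (\<Delta> - s^2 *\<^sub>R A) \<le> e * s^2" using elim(2) by (simp add: \<Delta>_def)
    have 2: "norm (\<Delta> - s^2 *\<^sub>R B) \<le> e * s^2"
      using elim(3) by (simp add: \<Delta>_def algebra_simps)
    have "s^2 * norm (A - B) = norm ((\<Delta> - s^2 *\<^sub>R B) - (\<Delta> - s^2 *\<^sub>R A))"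
      by (simp add: scaleR_diff_right[symmetric])
    also have "\<dots> \<le> 2 * e * s^2"
      using norm_triangle_ineq4[of "\<Delta> - s^2 *\<^sub>R B" "\<Delta> - s^2 *\<^sub>R A"] 1 2 by linarith
    finally show ?case using elim(1) by (simp add: mult.commute)
  qed
  then have "norm (A - B) \<le> 2 * e"
    by (simp add: eventually_const_iff)
  then show False using e by (simp add: e_def)
qed

section \<open>Euclidean coordinates and bounds for linear maps\<close>

text \<open>A finite type with as many elements as \<open>'e\<close> has dimensions (one in dimension 0), so that
  \<open>real ^ 'e basis_index\<close> is a Euclidean model of \<open>'e\<close>: the open mapping theorem and the theory of
  negligible sets are only available for the class \<open>euclidean_space\<close>.\<close>

typedef (overloaded) ('e::real_vector) basis_index =
  "if \<exists>S::'e set. is_basis S \<and> S \<noteq> {} then SOME S::'e set. is_basis S \<and> S \<noteq> {} else {0}"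
proof -
  have "\<exists>x. x \<in> (SOME S::'e set. is_basis S \<and> S \<noteq> {})" if "\<exists>S::'e set. is_basis S \<and> S \<noteq> {}"
    using someI_ex[OF that] by auto
  then show ?thesis by auto
qed

lemma range_Rep_basis_index:
  assumes "is_basis (S::'e::real_vector set)" "S \<noteq> {}"
  shows "is_basis (range (Rep_basis_index :: 'e basis_index \<Rightarrow> 'e))"
proof -
  have ex: "\<exists>S::'e set. is_basis S \<and> S \<noteq> {}" using assms by blast
  show ?thesis
    using someI_ex[OF ex] ex by (simp add: type_definition.Rep_range[OF type_definition_basis_index])
qed

instance basis_index :: (real_vector) finite
proof
  let ?B = "if \<exists>S::'a set. is_basis S \<and> S \<noteq> {} then SOME S::'a set. is_basis S \<and> S \<noteq> {} else {0}"
  have "finite ?B"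
    using someI_ex[of "\<lambda>S::'a set. is_basis S \<and> S \<noteq> {}"] by (auto simp: is_basis_def)
  then have "finite ((Abs_basis_index :: 'a \<Rightarrow> 'a basis_index) ` ?B)" by (rule finite_imageI)
  then show "finite (UNIV :: 'a basis_index set)"
    by (simp only: type_definition.Abs_image[OF type_definition_basis_index])
qed

lemma linear_bij_inverse:
  fixes T :: "'a::real_vector \<Rightarrow> 'b::real_vector"
  assumes "linear T" "bij T"
  obtains g where "linear g" "\<And>y. T (g y) = y" "\<And>x. g (T x) = x"
proof -
  obtain g where g: "linear g" "g \<circ> T = id"
    using linear_injective_left_inverse[OF assms(1)] assms(2) by (auto simp: bij_def)
  have "T (g y) = y" for y
    using g(2) assms(2) by (metis bij_pointE comp_apply id_apply)
  then show ?thesis using that g by (metis comp_apply id_apply)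
qed

text \<open>The coordinates refer to the basis chosen in \<open>basis_index\<close>;
  \<open>S\<close> witnesses that a nonempty basis exists. The isomorphism is purely algebraic here,
  its continuity follows below.\<close>

lemma euclidean_model:
  fixes S :: "'e::real_vector set"
  assumes "is_basis S" "S \<noteq> {}"
  obtains C :: "real ^ 'e basis_index \<Rightarrow> 'e" and D where
    "linear C" "linear D" "\<And>x. C (D x) = x" "\<And>z. D (C z) = z"
proof -
  have B: "is_basis (range (Rep_basis_index :: 'e basis_index \<Rightarrow> 'e))" (is "is_basis ?B")
    using range_Rep_basis_index[OF assms] .
  have inj: "inj (Rep_basis_index :: 'e basis_index \<Rightarrow> 'e)"
    by (meson Rep_basis_index_inject injI)
  define C where "C = (\<lambda>z :: real ^ 'e basis_index. \<Sum>i\<in>UNIV. (z $ i) *\<^sub>R Rep_basis_index i)"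
  have lC: "linear C"
    unfolding C_def by (rule linearI) (simp_all add: scaleR_left_distrib sum.distrib scaleR_sum_right)
  have "C z = 0 \<Longrightarrow> z = 0" for z
  proof -
    assume "C z = 0"
    then have "(\<Sum>b\<in>?B. (z $ inv_into UNIV Rep_basis_index b) *\<^sub>R b) = 0"
      using inj by (simp add: C_def sum.reindex)
    then have "\<forall>b\<in>?B. z $ inv_into UNIV Rep_basis_index b = 0"
      using B independentD[of ?B ?B "\<lambda>b. z $ inv_into UNIV Rep_basis_index b"] unfolding is_basis_def by blast
    then show "z = 0" using inj by (simp add: vec_eq_iff)
  qed
  then have injC: "inj C" using lC by (simp add: linear_injective_0)
  have "x \<in> range C" for x
  proof -
    have "x = (\<Sum>b\<in>?B. representation ?B x b *\<^sub>R b)"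
      using B unfolding is_basis_def by (simp add: real_vector.sum_representation_eq)
    also have "\<dots> = C (\<chi> i. representation ?B x (Rep_basis_index i))"
      using inj by (simp add: C_def sum.reindex)
    finally show ?thesis by blast
  qed
  then have surjC: "surj C" by blast
  show ?thesis
    using linear_bij_inverse[OF lC] injC surjC that[OF lC] unfolding bij_def by metis
qed

lemma zero_dimensional:
  assumes "is_basis ({}::'e::real_vector set)" shows "(x::'e) = 0"
  using assms by (auto simp: is_basis_def)

text \<open>On the compact Euclidean unit sphere the continuous map C attains a positive minimum m,
  so its inverse D is bounded by 1/m, and T = (T o C) o D with T o C linear on a Euclidean
  space.\<close>

lemma bounded_linear_finite_dim:
  fixes T :: "'e::real_normed_vector \<Rightarrow> 'f::real_normed_vector"
  assumes S: "is_basis (S::'e set)" and T: "linear T"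
  shows "bounded_linear T"
proof (cases "S = {}")
  case True
  then have "T = (\<lambda>x. 0)"
    using zero_dimensional[of] S linear_0[OF T] by (metis ext)
  then show ?thesis by simp
next
  case False
  obtain C :: "real ^ 'e basis_index \<Rightarrow> 'e" and D where
    C: "linear C" "linear D" "\<And>x. C (D x) = x" "\<And>z. D (C z) = z"
    using euclidean_model[OF S False] by metis
  have bC: "bounded_linear C" using C(1) by (simp add: linear_conv_bounded_linear)
  have "\<exists>m>0. \<forall>z. m * norm z \<le> norm (C z)"
  proof -
    have "continuous_on (sphere 0 1) (\<lambda>z. norm (C z))"
      using linear_continuous_on[OF bC] by (rule continuous_on_norm)
    then obtain z0 where z0: "z0 \<in> sphere 0 1" "\<And>z. z \<in> sphere 0 1 \<Longrightarrow> norm (C z0) \<le> norm (C z)"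
      using continuous_attains_inf[of "sphere (0::real ^ 'e basis_index) 1" "\<lambda>z. norm (C z)"]
by auto
    have "C z0 \<noteq> 0" using z0(1) C(4)[of z0] linear_0[OF C(2)] by auto
    moreover have "norm (C z0) * norm z \<le> norm (C z)" for z
    proof (cases "z = 0")
      case False
      have "norm (C z0) \<le> norm (C ((1 / norm z) *\<^sub>R z))" using False by (intro z0(2)) simp
      also have "\<dots> = norm (C z) / norm z" by (simp add: linear_scale[OF C(1)])
      finally show ?thesis using False by (simp add: field_simps)
    qed (simp add: linear_0[OF C(1)])
    ultimately show ?thesis by (intro exI[of _ "norm (C z0)"]) auto
  qed
  then obtain m where m: "m > 0" "\<And>z. m * norm z \<le> norm (C z)" by blast
  have "bounded_linear D"
    by (rule bounded_linear_intro[of _ "1/m"])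
       (use m(1) m(2)[of "D _"] C in \<open>auto simp: linear_add linear_scale field_simps\<close>)
  moreover have "bounded_linear (T \<circ> C)"
    using linear_compose[OF C(1) T] by (simp add: linear_conv_bounded_linear)
  ultimately have "bounded_linear (\<lambda>x. (T \<circ> C) (D x))" by (rule bounded_linear_compose[rotated])
  then show ?thesis by (simp add: C(3))
qed

text \<open>The same compactness argument for T o C. The minimum bounds T against the Euclidean norm
  of D x; dividing by the bound K of C turns this into a bound against norm x.\<close>

lemma inj_bounded_below_finite_dim:
  fixes T :: "'e::real_normed_vector \<Rightarrow> 'f::real_normed_vector"
  assumes S: "is_basis (S::'e set)" and T: "linear T" "inj T"
  obtains m where "m > 0" "\<And>x. m * norm x \<le> norm (T x)"
proof (cases "S = {}")
  case True
  show ?thesis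
  proof (rule that[of 1])
    show "1 * norm x \<le> norm (T x)" for x
      using zero_dimensional[of x] S True norm_zero by (metis mult_1 norm_ge_zero)
  qed simp
next
  case False
  obtain C :: "real ^ 'e basis_index \<Rightarrow> 'e" and D where
    C: "linear C" "linear D" "\<And>x. C (D x) = x" "\<And>z. D (C z) = z"
    using euclidean_model[OF S False] by metis
  have bC: "bounded_linear C" "bounded_linear D" "bounded_linear T"
    using C S T(1) by (auto simp: linear_conv_bounded_linear bounded_linear_finite_dim)
  obtain K where K: "K > 0" "\<And>z. norm (C z) \<le> norm z * K" using bounded_linear.pos_bounded[OF bC(1)] by blast
  have "continuous_on (sphere 0 1) (\<lambda>z. norm (T (C z)))"
    using linear_continuous_on[OF bounded_linear_compose[OF bC(3,1)]] by (rule continuous_on_norm)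
  then obtain z0 where z0: "z0 \<in> sphere 0 1" "\<And>z. z \<in> sphere 0 1 \<Longrightarrow> norm (T (C z0)) \<le> norm (T (C z))"
    using continuous_attains_inf[of "sphere (0::real ^ 'e basis_index) 1" "\<lambda>z. norm (T (C z))"] by auto
  have "C z0 \<noteq> 0" using z0(1) C(4)[of z0] linear_0[OF C(2)] by auto
  then have pos: "norm (T (C z0)) > 0" using linear_injective_0[OF T(1)] T(2) by auto
  have *: "norm (T (C z0)) * norm z \<le> norm (T (C z))" for z
  proof (cases "z = 0")
    case False
    have "norm (T (C z0)) \<le> norm (T (C ((1 / norm z) *\<^sub>R z)))" using False by (intro z0(2)) simp
    also have "\<dots> = norm (T (C z)) / norm z" by (simp add: linear_scale[OF C(1)] linear_scale[OF T(1)])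
    finally show ?thesis using False by (simp add: field_simps)
  qed (simp add: linear_0[OF C(1)] linear_0[OF T(1)])
  show ?thesis
  proof (rule that[of "norm (T (C z0)) / K"])
    show "norm (T (C z0)) / K > 0" using pos K by simp
    fix x
    have "norm x \<le> norm (D x) * K" using K(2)[of "D x"] C(3) by simp
    then have "norm (T (C z0)) / K * norm x \<le> norm (T (C z0)) * norm (D x)"
      using pos K(1) by (simp add: field_simps)
    also have "\<dots> \<le> norm (T x)" using *[of "D x"] C(3) by simp
    finally show "norm (T (C z0)) / K * norm x \<le> norm (T x)" .
  qed
qed

text \<open>Cramer's rule without determinants. Freezing the solution at x0 leaves the residual r x
  = y - T x (X x0), and T x (X x - X x0) = r x, so the derivative of X has to be the inverse of T x0
  applied to that of r. This yields the differentiability of the horizontal lifts.\<close>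

lemma differentiable_solution:
  fixes T :: "'a::real_normed_vector \<Rightarrow> 'e::real_normed_vector \<Rightarrow> 'f::real_normed_vector"
  assumes B: "is_basis (B::'e set)" and N: "open N" "x0 \<in> N"
    and lin: "\<And>x. x \<in> N \<Longrightarrow> linear (T x)" and bij: "bij (T x0)"
    and sol: "\<And>x. x \<in> N \<Longrightarrow> T x (X x) = y"
    and diff: "\<And>u. (\<lambda>x. T x u) differentiable (at x0)"
  shows "X differentiable (at x0)"
proof -
  let ?T0 = "T x0" and ?X0 = "X x0"
  have linT0: "linear ?T0" using lin N by blast
  obtain m where m: "m > 0" "\<And>u. m * norm u \<le> norm (?T0 u)"
    using inj_bounded_below_finite_dim[OF B linT0] bij bij_is_inj by metis
  obtain g where g: "linear g" "\<And>w. ?T0 (g w) = w"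
    using linear_bij_inverse[OF linT0 bij] by metis
  \<comment> \<open>Up to the constant K this bounds the operator norm of T x - T x0, yet it
    involves only the finitely many maps \<open>\<lambda>x. T x b\<close>, so pointwise
    differentiability makes it tend to 0.\<close>
  define E where "E = (\<lambda>x. \<Sum>b\<in>B. norm (T x b - ?T0 b))"
  have "\<exists>K\<ge>0. \<forall>u. \<forall>b\<in>B. \<bar>representation B u b\<bar> \<le> K * norm u"
  proof -
    have ind: "independent B" "span B = UNIV" "finite B" using B by (auto simp: is_basis_def)
    have "linear (\<lambda>u. representation B u b)" for b
      using ind by (intro linearI) (simp_all add: real_vector.representation_add real_vector.representation_scale)
    then have "bounded_linear (\<lambda>u. representation B u b)" for b
      using bounded_linear_finite_dim[OF B] by blast
    then have "\<forall>b. \<exists>K\<ge>0. \<forall>u. \<bar>representation B u b\<bar> \<le> norm u * K"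
      by (metis bounded_linear.nonneg_bounded real_norm_def)
    then obtain k where k: "\<And>b. k b \<ge> 0" "\<And>b u. \<bar>representation B u b\<bar> \<le> norm u * k b" by metis
    have "\<bar>representation B u b\<bar> \<le> (\<Sum>b\<in>B. k b) * norm u" if "b \<in> B" for u b
    proof -
      have "k b \<le> (\<Sum>b\<in>B. k b)" using ind(3) k(1) that by (simp add: member_le_sum)
      then show ?thesis
        using k(2)[of u b] mult_left_mono[of "k b" "sum k B" "norm u"] by (simp add: mult.commute)
    qed
    then show ?thesis by (intro exI[of _ "\<Sum>b\<in>B. k b"]) (auto intro: sum_nonneg k(1))
  qed
  then obtain K where K: "K \<ge> 0" "\<And>u b. b \<in> B \<Longrightarrow> \<bar>representation B u b\<bar> \<le> K * norm u" by metis
  have E: "norm (T x u - ?T0 u) \<le> K * E x * norm u" if "x \<in> N" for x u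
  proof -
    have u: "u = (\<Sum>b\<in>B. representation B u b *\<^sub>R b)"
      using B by (simp add: is_basis_def real_vector.sum_representation_eq)
    have exp: "A u = (\<Sum>b\<in>B. representation B u b *\<^sub>R A b)" if "linear A" for A :: "'e \<Rightarrow> 'f"
      using arg_cong[OF u, of A] by (simp add: linear_sum[OF that] linear_scale[OF that])
    have "T x u - ?T0 u = (\<Sum>b\<in>B. representation B u b *\<^sub>R (T x b - ?T0 b))"
      unfolding exp[OF lin[OF that]] exp[OF linT0] by (simp add: sum_subtractf scaleR_diff_right)
    also have "norm \<dots> \<le> (\<Sum>b\<in>B. K * norm u * norm (T x b - ?T0 b))"
      by (rule sum_norm_le) (auto intro!: mult_right_mono K(2))
    also have "\<dots> = K * E x * norm u" by (simp add: E_def sum_distrib_left mult_ac)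
    finally show ?thesis .
  qed
  define r where "r = (\<lambda>x. y - T x ?X0)"
  have r0: "r x0 = 0" using sol N by (simp add: r_def)
  define r' where "r' = (\<lambda>h. - fd (\<lambda>x. T x ?X0) x0 h)"
  have r': "(r has_derivative r') (at x0)"
    unfolding r_def r'_def using has_derivative_diff[OF has_derivative_const has_derivative_fd[OF diff], of y] by simp
  then interpret r': bounded_linear r' by (rule has_derivative_bounded_linear)
  have eq: "T x (X x - ?X0) = r x" if "x \<in> N" for x
    using linear_diff[OF lin[OF that]] sol[OF that] by (simp add: r_def)
  define X' where "X' = g \<circ> r'"
  have bX: "bounded_linear X'"
  proof -
    obtain L where L: "\<And>h. norm (r' h) \<le> norm h * L" using r'.bounded by blast
    have "norm (X' h) \<le> norm h * (L / m)" for h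
      using m(2)[of "X' h"] L[of h] m(1) g(2) by (simp add: X'_def field_simps)
    moreover have "linear X'" unfolding X'_def by (rule linear_compose[OF r'.linear g(1)])
    ultimately show ?thesis
      by (intro bounded_linear_intro[of _ "L/m"]) (auto simp: linear_add linear_scale)
  qed
  have contE: "(E \<longlongrightarrow> 0) (at x0)"
  proof -
    have "((\<lambda>x. norm (T x b - ?T0 b)) \<longlongrightarrow> 0) (at x0)" for b
      using differentiable_imp_continuous_within[OF diff, of b]
      by (simp add: continuous_within tendsto_norm_zero LIM_zero)
    then show ?thesis unfolding E_def by (intro tendsto_null_sum) auto
  qed
  have evN: "\<forall>\<^sub>F x in at x0. x \<in> N" using N by (rule eventually_at_in_open')
  \<comment> \<open>Below m / 2 the perturbation is absorbed by the lower bound of T x0, leaving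
    norm (X x - X x0) \<le> 2 / m * norm (r x).\<close>
  have half: "\<forall>\<^sub>F x in at x0. K * E x < m / 2"
    using tendsto_mult_right_zero[OF contE, of K] m(1) by (intro order_tendstoD(2)) auto
  have ev: "\<forall>\<^sub>F x in at x0. x \<in> N \<and> m / 2 * norm (X x - ?X0) \<le> norm (r x)"
    using evN half
  proof eventually_elim
    case (elim x)
    have "m * norm (X x - ?X0) \<le> norm (?T0 (X x - ?X0))" by (rule m(2))
    also have "\<dots> \<le> norm (r x) + norm (T x (X x - ?X0) - ?T0 (X x - ?X0))"
      using eq[OF elim(1)] by (metis add.commute norm_minus_commute norm_triangle_sub)
    also have "\<dots> \<le> norm (r x) + K * E x * norm (X x - ?X0)"
      using E[OF elim(1)] by simp
    also have "\<dots> \<le> norm (r x) + m / 2 * norm (X x - ?X0)"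
      using elim(2) by (intro add_left_mono mult_right_mono) auto
    finally show ?case using elim(1) by simp
  qed
  have "(X has_derivative X') (at x0)"
    unfolding has_derivative_iff_norm
  proof
    show "bounded_linear X'" by (rule bX)
    have lim_r: "((\<lambda>x. norm (r x - r x0 - r' (x - x0)) / norm (x - x0)) \<longlongrightarrow> 0) (at x0)"
      using r' unfolding has_derivative_iff_norm by blast
    obtain L where L: "\<And>h. norm (r' h) \<le> norm h * L" using r'.bounded by blast
    have up: "\<forall>\<^sub>F x in at x0. norm (X x - ?X0 - X' (x - x0)) / norm (x - x0)
      \<le> (1 / m) * (1 + 2 * K * E x / m) * (norm (r x - r x0 - r' (x - x0)) / norm (x - x0))
        + (1 / m) * (2 * K * E x / m) * L"
      using ev eventually_neq_at_within[of x0]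
    proof eventually_elim
      case (elim x)
      let ?h = "x - x0" and ?\<epsilon> = "norm (r x - r x0 - r' (x - x0))"
      have h: "norm ?h > 0" using elim by simp
      have Epos: "E x \<ge> 0" by (simp add: E_def sum_nonneg)
      \<comment> \<open>T x0 maps the remainder of X to the remainder of r minus (T x - T x0) (X x -
        X x0). The latter is at most a constant times E x * norm (r x), where norm (r x) is
        controlled by the remainder of r and a multiple of norm ?h; both contributions are o(norm
        ?h).\<close>
      have "?T0 (X x - ?X0 - X' ?h) = (r x - r x0 - r' ?h) - (T x (X x - ?X0) - ?T0 (X x - ?X0))"
        using eq elim r0 by (simp add: linear_diff[OF linT0] X'_def g(2))
      then have "m * norm (X x - ?X0 - X' ?h) \<le> ?\<epsilon> + norm (T x (X x - ?X0) - ?T0 (X x - ?X0))"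
        using m(2)[of "X x - ?X0 - X' ?h"] norm_triangle_ineq4 by (metis order_trans)
      also have "\<dots> \<le> ?\<epsilon> + K * E x * norm (X x - ?X0)" using E elim by simp
      also have "\<dots> \<le> ?\<epsilon> + K * E x * (2 / m * norm (r x))"
        using elim m(1) K(1) Epos by (intro add_left_mono mult_left_mono) (auto simp: field_simps)
      also have "\<dots> \<le> ?\<epsilon> + K * E x * (2 / m * (?\<epsilon> + L * norm ?h))"
      proof -
        have "norm (r x) \<le> ?\<epsilon> + norm (r' ?h)"
          using norm_triangle_sub[of "r x" "r' ?h"] r0 by (simp add: add.commute)
        then have "norm (r x) \<le> ?\<epsilon> + L * norm ?h" using L[of ?h] by (simp add: mult.commute)
        then show ?thesis using m(1) K(1) Epos by (intro add_left_mono mult_left_mono) auto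
      qed
      finally have "m * norm (X x - ?X0 - X' ?h) \<le> (1 + 2 * K * E x / m) * ?\<epsilon> + (2 * K * E x / m) * L * norm ?h"
        by (simp add: algebra_simps)
      then have "norm (X x - ?X0 - X' ?h) \<le> (1 / m) * ((1 + 2 * K * E x / m) * ?\<epsilon> + (2 * K * E x / m) * L * norm ?h)"
        using m(1) by (simp add: field_simps)
      then have "norm (X x - ?X0 - X' ?h) / norm ?h
          \<le> (1 / m) * ((1 + 2 * K * E x / m) * ?\<epsilon> + (2 * K * E x / m) * L * norm ?h) / norm ?h"
        by (rule divide_right_mono) simp
      also have "\<dots> = (1 / m) * (1 + 2 * K * E x / m) * (?\<epsilon> / norm ?h) + (1 / m) * (2 * K * E x / m) * L"
      proof -
        have "(1 / m) * (a * \<epsilon> + b * L * n) / n = (1 / m) * a * (\<epsilon> / n) + (1 / m) * b * L"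
          if "n > 0" for a b \<epsilon> n :: real
          using that m(1) by (simp add: field_simps)
        then show ?thesis using h by blast
      qed
      finally show ?case .
    qed
    have "((\<lambda>x. (1 / m) * (1 + 2 * K * E x / m) * (norm (r x - r x0 - r' (x - x0)) / norm (x - x0))
        + (1 / m) * (2 * K * E x / m) * L) \<longlongrightarrow> (1 / m) * (1 + 2 * K * 0 / m) * 0 + (1 / m) * (2 * K * 0 / m) * L) (at x0)"
      using m(1) by (intro tendsto_intros contE lim_r) auto
    then have lim: "((\<lambda>x. (1 / m) * (1 + 2 * K * E x / m) * (norm (r x - r x0 - r' (x - x0)) / norm (x - x0))
        + (1 / m) * (2 * K * E x / m) * L) \<longlongrightarrow> 0) (at x0)" by simp
    show "((\<lambda>x. norm (X x - X x0 - X' (x - x0)) / norm (x - x0)) \<longlongrightarrow> 0) (at x0)"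
      by (rule tendsto_sandwich[OF _ up tendsto_const lim]) simp
  qed
  then show ?thesis by (rule differentiableI)
qed

text \<open>With a right inverse \<open>\<sigma>\<close> of \<open>DF(x\<^sub>0)\<close> and the projection \<open>P = id - \<sigma> DF(x\<^sub>0)\<close>, the map
  \<open>\<Phi> = \<sigma> (F - F(x\<^sub>0)) + P\<close> has derivative \<open>id\<close> at \<open>x\<^sub>0\<close>, so its image contains an open set. If
  \<open>(DF(x\<^sub>0), A)\<close> had a kernel, then the fibre of \<open>F\<close> would be so small that a neighbourhood
  in this image is covered by countably many differentiable images of a proper subspace.\<close>

lemma fibre_dimension_injective:
  fixes F :: "'e::real_normed_vector \<Rightarrow> 'b::real_normed_vector" and A :: "'e \<Rightarrow> 'l::real_normed_vector"
    and \<psi> :: "'i \<Rightarrow> 'l \<Rightarrow> 'e"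
  assumes S: "is_basis (S::'e set)" and SB: "is_basis (SB::'b set)"
    and U: "open U" "x0 \<in> U" and F: "\<And>x. x \<in> U \<Longrightarrow> F differentiable (at x)"
    and A: "linear A" and surj: "surj (\<lambda>u. (fd F x0 u, A u))" and cnt: "countable \<D>"
    and \<psi>: "\<And>d \<xi>. d \<in> \<D> \<Longrightarrow> \<xi> \<in> N d \<Longrightarrow> \<psi> d differentiable (at \<xi>)"
    and cover: "\<And>x. x \<in> U \<Longrightarrow> F x = F x0 \<Longrightarrow> \<exists>d\<in>\<D>. \<exists>\<xi>\<in>N d. x = \<psi> d \<xi>"
  shows "inj (\<lambda>u. (fd F x0 u, A u))"
proof (rule ccontr)
  assume ninj: "\<not> inj (\<lambda>u. (fd F x0 u, A u))"
  define DF where "DF = fd F x0"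
  have F': "(F has_derivative DF) (at x0)" unfolding DF_def using F U(2) has_derivative_fd by blast
  have DF: "linear DF" using F' has_derivative_linear by blast
  have linT: "linear (\<lambda>u. (DF u, A u))"
    using DF A by (intro linearI) (auto simp: linear_add linear_scale)
  obtain k where k: "k \<noteq> 0" "DF k = 0" "A k = 0"
    using ninj linT unfolding DF_def[symmetric] by (auto simp: linear_injective_0 zero_prod_def)
  have "S \<noteq> {}" using k(1) S zero_dimensional by blast
  then obtain C :: "real ^ 'e basis_index \<Rightarrow> 'e" and D where
    C: "linear C" "linear D" "\<And>x. C (D x) = x" "\<And>z. D (C z) = z"
    using euclidean_model[OF S] by metis
  obtain \<rho> where \<rho>: "linear \<rho>" "(\<lambda>u. (DF u, A u)) \<circ> \<rho> = id"
    using linear_surjective_right_inverse[OF linT] surj unfolding DF_def by blast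
  then have \<rho>': "DF (\<rho> w) = fst w" "A (\<rho> w) = snd w" for w
    by (metis (mono_tags, lifting) comp_apply fst_conv id_apply, metis (mono_tags, lifting) comp_apply snd_conv id_apply)
  define \<sigma> where "\<sigma> = (\<lambda>y. \<rho> (y, 0))"
  have \<sigma>: "linear \<sigma>" "\<And>y. DF (\<sigma> y) = y"
    using linear_compose[of "\<lambda>y. (y, 0)" \<rho>] \<rho>(1) \<rho>' by (auto simp: \<sigma>_def o_def linear_iff)
  define P where "P = (\<lambda>u. u - \<sigma> (DF u))"
  have P: "linear P" unfolding P_def
    by (intro linearI) (simp_all add: linear_add[OF DF] linear_add[OF \<sigma>(1)] linear_scale[OF DF]
        linear_scale[OF \<sigma>(1)] algebra_simps)
  have DFP: "DF (P u) = 0" for u by (simp add: P_def linear_diff[OF DF] \<sigma>(2))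
  have PP: "P (P u) = P u" for u using DFP[of u] by (simp add: P_def linear_0[OF \<sigma>(1)])
  have bl: "bounded_linear C" "bounded_linear D" "bounded_linear \<sigma>" "bounded_linear P" "bounded_linear A" "bounded_linear DF"
    using C \<sigma> P A DF S SB by (auto simp: linear_conv_bounded_linear bounded_linear_finite_dim)
  define \<Phi> where "\<Phi> = (\<lambda>x. \<sigma> (F x - F x0) + P x)"
  have d\<Phi>: "((\<lambda>x. D (\<Phi> x)) has_derivative (\<lambda>h. D (\<sigma> (F' h) + P h))) (at x)"
    if "(F has_derivative F') (at x)" for x F'
    unfolding \<Phi>_def
    using that by (auto intro!: derivative_eq_intros bounded_linear.has_derivative[OF bl(2)]
        bounded_linear.has_derivative[OF bl(3)] bounded_linear.has_derivative[OF bl(4)])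
  have "((\<lambda>x. D (\<Phi> x)) has_derivative D) (at x0)"
    using d\<Phi>[OF F'] by (simp add: P_def)
  moreover have "continuous_on U (\<lambda>x. D (\<Phi> x))"
    using d\<Phi>[OF has_derivative_fd[OF F]] has_derivative_continuous continuous_at_imp_continuous_on by blast
  \<comment> \<open>F is merely differentiable on U, so openness comes from a derivative with right
    inverse at the one point x0, here D with right inverse C, instead of the inverse function
    theorem.\<close>
  ultimately have int: "D (\<Phi> x0) \<in> interior ((\<lambda>x. D (\<Phi> x)) ` U)"
    using U C by (intro sussmann_open_mapping[of U _ x0 D C U]) (auto simp: bl interior_open fun_eq_iff)
  define W where "W = interior ((\<lambda>x. D (\<Phi> x)) ` U)"
  \<comment> \<open>For z in W', P (C z) is itself a value \<Phi> x; since DF kills the range of P,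
    this x satisfies F x = F x0, and \<open>cover\<close> applies to it. The set contains D (\<Phi>
    x0) because \<Phi> x0 = P x0 and P is idempotent.\<close>
  define W' where "W' = W \<inter> (\<lambda>z. D (P (C z))) -` W"
  have "continuous_on UNIV (\<lambda>z. D (P (C z)))"
    by (intro linear_continuous_on bounded_linear_compose[OF bl(2)] bounded_linear_compose[OF bl(4)] bl(1))
  then have oW': "open W'"
    unfolding W'_def W_def by (intro open_Int open_interior open_vimage) auto
  have \<Phi>0: "\<Phi> x0 = P x0" by (simp add: \<Phi>_def linear_0[OF \<sigma>(1)])
  then have neW': "D (\<Phi> x0) \<in> W'" using int by (simp add: W'_def W_def C PP)
  \<comment> \<open>H is the parameter space: \<rho> (y, \<xi>) carries a transverse component y and
    a chart coordinate \<xi>, recovered by DF and A. The kernel vector k lies outside the range of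
    \<rho>, so H is proper.\<close>
  define H where "H = D ` range \<rho>"
  have subH: "subspace H"
    unfolding H_def using C(2) \<rho>(1) by (intro linear_subspace_image) auto
  have "D k \<notin> H"
  proof
    assume "D k \<in> H"
    then obtain w where "D k = D (\<rho> w)" by (auto simp: H_def)
    then have "k = \<rho> w" using C(3) by metis
    then have "w = 0" using \<rho>'[of w] k by (simp add: prod_eq_iff)
    then show False using \<open>k = \<rho> w\<close> k(1) linear_0[OF \<rho>(1)] by simp
  qed
  then have "span H \<noteq> UNIV" using subH by (metis UNIV_I span_eq_iff)
  then have "dim H < DIM(real ^ 'e basis_index)"
    using dim_eq_full[of H] dim_subset_UNIV[of H] by linarith
  then have negH: "negligible H" by (rule negligible_lowdim)
  \<comment> \<open>A point is rebuilt from its two parts: \<sigma> restores what DF sees, and the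
    fibre point \<psi> d (A (C z)) supplies the part in the kernel of DF.\<close>
  define g where "g = (\<lambda>d z. D (\<sigma> (DF (C z)) + P (\<psi> d (A (C z)))))"
  define K where "K = (\<lambda>d. {z \<in> H. A (C z) \<in> N d})"
  have "negligible (g d ` K d)" if d: "d \<in> \<D>" for d
  proof (rule negligible_differentiable_image_negligible)
    show "negligible (K d)" by (rule negligible_subset[OF negH]) (auto simp: K_def)
    show "g d differentiable_on K d"
      unfolding differentiable_on_def
    proof
      fix z assume "z \<in> K d"
      then have "\<psi> d differentiable (at (A (C z)))" using \<psi>[OF d] by (simp add: K_def)
      then obtain \<psi>' where p: "(\<psi> d has_derivative \<psi>') (at (A (C z)))" by (auto simp: differentiable_def)
      have AC: "((\<lambda>z. A (C z)) has_derivative (\<lambda>z. A (C z))) (at z)"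
        using bounded_linear_compose[OF bl(5,1)] by (rule bounded_linear_imp_has_derivative)
      have "((\<lambda>z. \<psi> d (A (C z))) has_derivative (\<lambda>h. \<psi>' (A (C h)))) (at z)"
        by (rule has_derivative_compose[OF AC p])
      moreover have "((\<lambda>z. \<sigma> (DF (C z))) has_derivative (\<lambda>z. \<sigma> (DF (C z)))) (at z)"
        using bounded_linear_compose[OF bl(3) bounded_linear_compose[OF bl(6,1)]] by (rule bounded_linear_imp_has_derivative)
      ultimately have "(g d has_derivative (\<lambda>h. D (\<sigma> (DF (C h)) + P (\<psi>' (A (C h)))))) (at z)"
        unfolding g_def
        by (intro bounded_linear.has_derivative[OF bl(2)] has_derivative_add bounded_linear.has_derivative[OF bl(4)])
      then show "g d differentiable at z within K d"
        using differentiableI differentiable_at_withinI by blast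
    qed
  qed simp
  then have "negligible (\<Union>d\<in>\<D>. g d ` K d)" using cnt by (intro negligible_countable_Union) auto
  moreover have "W' \<subseteq> (\<Union>d\<in>\<D>. g d ` K d)"
  proof
    fix z assume "z \<in> W'"
    then have "D (P (C z)) \<in> (\<lambda>x. D (\<Phi> x)) ` U" using interior_subset by (auto simp: W'_def W_def)
    then obtain x where x: "x \<in> U" "D (P (C z)) = D (\<Phi> x)" by auto
    then have Px: "P (C z) = \<Phi> x" using C(3) by metis
    have "DF (\<Phi> x) = F x - F x0" by (simp add: \<Phi>_def linear_add[OF DF] \<sigma>(2) DFP)
    then have Fx: "F x = F x0" using DFP[of "C z"] Px by simp
    then obtain d \<xi> where d: "d \<in> \<D>" "\<xi> \<in> N d" "x = \<psi> d \<xi>" using cover[OF x(1)] by blast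
    define y where "y = D (\<rho> (DF (C z), \<xi>))"
    have y: "C y = \<rho> (DF (C z), \<xi>)" by (simp add: y_def C)
    have "y \<in> K d" using d(2) y \<rho>' by (simp add: K_def) (simp add: y_def H_def)
    moreover have "g d y = z"
    proof -
      have "P x = P (C z)" using Px Fx by (simp add: \<Phi>_def linear_0[OF \<sigma>(1)])
      then show ?thesis using y \<rho>' d(3) by (simp add: g_def) (simp add: P_def C)
    qed
    ultimately show "z \<in> (\<Union>d\<in>\<D>. g d ` K d)" using d(1) by blast
  qed
  ultimately have "negligible W'" by (rule negligible_subset)
  then show False using open_not_negligible[OF oW'] neW' by blast
qed

section \<open>Charts\<close>

lemma is_chart_inj: "is_chart T c \<Longrightarrow> inj_on (snd c) (fst c)"
  unfolding is_chart_def using homeomorphic_imp_injective_map[of "subtopology T (fst c)"]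
  by (metis openin_subset topspace_subtopology_subset)

lemma chart_inv_snd: "is_chart T c \<Longrightarrow> q \<in> fst c \<Longrightarrow> chart_inv c (snd c q) = q"
  unfolding chart_inv_def using is_chart_inj by (metis inv_into_f_f)

lemma snd_chart_inv: "x \<in> snd c ` fst c \<Longrightarrow> snd c (chart_inv c x) = x"
  unfolding chart_inv_def by (rule f_inv_into_f)

lemma chart_inv_in: "x \<in> snd c ` fst c \<Longrightarrow> chart_inv c x \<in> fst c"
  unfolding chart_inv_def by (rule inv_into_into)

lemma is_chart_subset: "is_chart T c \<Longrightarrow> fst c \<subseteq> topspace T"
  unfolding is_chart_def by (simp add: openin_subset)

lemma continuous_map_chart_inv:
  assumes "is_chart T c"
  shows "continuous_map (top_of_set (snd c ` fst c)) T (chart_inv c)"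
proof -
  have "homeomorphic_map (subtopology T (fst c)) (top_of_set (snd c ` fst c)) (snd c)"
    using assms by (simp add: is_chart_def)
  then obtain g where g: "homeomorphic_maps (subtopology T (fst c)) (top_of_set (snd c ` fst c)) (snd c) g"
    using homeomorphic_map_maps by blast
  have "continuous_map (top_of_set (snd c ` fst c)) (subtopology T (fst c)) g"
    using g by (simp add: homeomorphic_maps_def)
  then have "continuous_map (top_of_set (snd c ` fst c)) T g"
    using continuous_map_into_fulltopology by blast
  then show ?thesis
  proof (rule continuous_map_eq)
    fix x assume "x \<in> topspace (top_of_set (snd c ` fst c))"
    then obtain q where q: "q \<in> fst c" "x = snd c q" by auto
    then have "g x = q"
      using g is_chart_subset[OF assms] by (auto simp: homeomorphic_maps_def)
    then show "g x = chart_inv c x" using q chart_inv_snd[OF assms] by simp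
  qed
qed

lemma open_chart_preimage:
  assumes c: "is_chart T c" and f: "continuous_map T T' f" and V: "openin T' V"
  shows "open {x \<in> snd c ` fst c. f (chart_inv c x) \<in> V}"
proof -
  have "continuous_map (top_of_set (snd c ` fst c)) T' (f \<circ> chart_inv c)"
    using continuous_map_compose[OF continuous_map_chart_inv[OF c] f] .
  then have "openin (top_of_set (snd c ` fst c)) {x \<in> snd c ` fst c. (f \<circ> chart_inv c) x \<in> V}"
    using openin_continuous_map_preimage[OF _ V] by fastforce
  moreover have "open (snd c ` fst c)" using c by (simp add: is_chart_def)
  ultimately show ?thesis by (simp add: openin_open_eq)
qed

lemma chart_image_Collect:
  assumes "is_chart T c"
  shows "snd c ` {q \<in> fst c. P q} = {x \<in> snd c ` fst c. P (chart_inv c x)}"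
  using chart_inv_snd[OF assms] by auto

lemma smooth_manifold_chart: "smooth_manifold M \<Longrightarrow> c \<in> atlas M \<Longrightarrow> is_chart (mtop M) c"
  by (simp add: smooth_manifold_def)

lemma chart_at_atlas:
  assumes "smooth_manifold M" "q \<in> topspace (mtop M)"
  shows "chart_at M q \<in> atlas M" "q \<in> fst (chart_at M q)"
proof -
  have "q \<in> (\<Union>c\<in>atlas M. fst c)" using assms unfolding smooth_manifold_def by blast
  then have "\<exists>c. c \<in> atlas M \<and> q \<in> fst c" by blast
  from someI_ex[OF this] show "chart_at M q \<in> atlas M" "q \<in> fst (chart_at M q)"
    unfolding chart_at_def by auto
qed

lemma open_transition_domain:
  assumes M: "smooth_manifold M" and c: "c \<in> atlas M" and d: "d \<in> atlas M"
  shows "open (snd c ` (fst c \<inter> fst d))"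
proof -
  have "snd c ` (fst c \<inter> fst d) = {x \<in> snd c ` fst c. id (chart_inv c x) \<in> fst d}"
    using chart_image_Collect[OF smooth_manifold_chart[OF M c], of "\<lambda>q. q \<in> fst d"]
    by (simp add: Collect_conj_eq)
  also have "open \<dots>"
    using smooth_manifold_chart[OF M d]
    by (intro open_chart_preimage[OF smooth_manifold_chart[OF M c] continuous_map_id]) (simp add: is_chart_def)
  finally show ?thesis .
qed

lemma transition_differentiable:
  assumes M: "smooth_manifold M" and "c \<in> atlas M" "d \<in> atlas M" "q \<in> fst c" "q \<in> fst d"
  shows "(snd d \<circ> chart_inv c) differentiable (at (snd c q))"
proof (rule smooth_on_differentiable)
  show "smooth_on (snd d \<circ> chart_inv c) (snd c ` (fst c \<inter> fst d))"
    using assms by (simp add: smooth_manifold_def)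
qed (use assms in auto)

section \<open>Change of charts\<close>

text \<open>Chain rule through the transition map, valid on the overlap of the two domains.
  \<open>f\<close> is any map into a normed space, so both transition maps and the projection in
  coordinates are covered.\<close>

lemma fd_change_source:
  assumes M: "smooth_manifold M" and c: "c \<in> atlas M" "q \<in> fst c" and c': "c' \<in> atlas M" "q \<in> fst c'"
    and f: "(f \<circ> chart_inv c') differentiable (at (snd c' q))"
  shows "(f \<circ> chart_inv c) differentiable (at (snd c q))"
    and "fd (f \<circ> chart_inv c) (snd c q) v = fd (f \<circ> chart_inv c') (snd c' q) (fd (snd c' \<circ> chart_inv c) (snd c q) v)"
proof -
  note ch = smooth_manifold_chart[OF M c(1)] smooth_manifold_chart[OF M c'(1)]
  have t: "(snd c' \<circ> chart_inv c) differentiable (at (snd c q))"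
    by (rule transition_differentiable[OF M c(1) c'(1) c(2) c'(2)])
  have q: "(snd c' \<circ> chart_inv c) (snd c q) = snd c' q" using chart_inv_snd[OF ch(1) c(2)] by simp
  have f': "(f \<circ> chart_inv c') differentiable (at ((snd c' \<circ> chart_inv c) (snd c q)))" using f q by simp
  have eq: "((f \<circ> chart_inv c') \<circ> (snd c' \<circ> chart_inv c)) x = (f \<circ> chart_inv c) x"
    if "x \<in> snd c ` (fst c \<inter> fst c')" for x
    using that chart_inv_snd[OF ch(1)] chart_inv_snd[OF ch(2)] by auto
  have op: "open (snd c ` (fst c \<inter> fst c'))" "snd c q \<in> snd c ` (fst c \<inter> fst c')"
    using open_transition_domain[OF M c(1) c'(1)] c c' by auto
  show "(f \<circ> chart_inv c) differentiable (at (snd c q))"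
    by (rule differentiable_cong_open[OF differentiable_chain_at[OF t f'] op eq])
  have "fd ((f \<circ> chart_inv c') \<circ> (snd c' \<circ> chart_inv c)) (snd c q) = fd (f \<circ> chart_inv c) (snd c q)"
    by (rule fd_cong_open[OF op eq])
  then show "fd (f \<circ> chart_inv c) (snd c q) v = fd (f \<circ> chart_inv c') (snd c' q) (fd (snd c' \<circ> chart_inv c) (snd c q) v)"
    using frechet_derivative_compose[OF t f'] q by (metis comp_apply)
qed

text \<open>Again the chain rule. W keeps h inside both chart domains, where the transition map
  links the two coordinate expressions.\<close>

lemma fd_change_target:
  assumes M: "smooth_manifold M" and d: "d \<in> atlas M" and d': "d' \<in> atlas M"
    and W: "open W" "x0 \<in> W" "\<And>x. x \<in> W \<Longrightarrow> h x \<in> fst d \<inter> fst d'"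
    and h: "(snd d \<circ> h) differentiable (at x0)"
  shows "(snd d' \<circ> h) differentiable (at x0)"
    and "fd (snd d' \<circ> h) x0 v = fd (snd d' \<circ> chart_inv d) (snd d (h x0)) (fd (snd d \<circ> h) x0 v)"
proof -
  have t: "(snd d' \<circ> chart_inv d) differentiable (at ((snd d \<circ> h) x0))"
    using transition_differentiable[OF M d d', of "h x0"] W by auto
  have eq: "((snd d' \<circ> chart_inv d) \<circ> (snd d \<circ> h)) x = (snd d' \<circ> h) x" if "x \<in> W" for x
    using W(3)[OF that] chart_inv_snd[OF smooth_manifold_chart[OF M d]] by simp
  show "(snd d' \<circ> h) differentiable (at x0)"
    by (rule differentiable_cong_open[OF differentiable_chain_at[OF h t] W(1,2) eq])
  have "fd ((snd d' \<circ> chart_inv d) \<circ> (snd d \<circ> h)) x0 = fd (snd d' \<circ> h) x0"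
    by (rule fd_cong_open[OF W(1,2) eq])
  then show "fd (snd d' \<circ> h) x0 v = fd (snd d' \<circ> chart_inv d) (snd d (h x0)) (fd (snd d \<circ> h) x0 v)"
    using frechet_derivative_compose[OF h t] by (metis comp_apply)
qed

lemma fd_chart_id:
  assumes "is_chart T c" "q \<in> fst c" shows "fd (snd c \<circ> chart_inv c) (snd c q) = id"
proof -
  have "fd (snd c \<circ> chart_inv c) (snd c q) = fd id (snd c q)"
    using assms by (intro fd_cong_open[of "snd c ` fst c"]) (auto simp: is_chart_def snd_chart_inv)
  then show ?thesis by simp
qed

lemma fd_transition_inverse:
  assumes M: "smooth_manifold M" and c: "c \<in> atlas M" "q \<in> fst c" and d: "d \<in> atlas M" "q \<in> fst d"
  shows "fd (snd c \<circ> chart_inv d) (snd d q) (fd (snd d \<circ> chart_inv c) (snd c q) v) = v"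
  using fd_change_source(2)[OF M c d, of "snd c" v] fd_chart_id[OF smooth_manifold_chart[OF M c(1)] c(2)]
    transition_differentiable[OF M d(1) c(1) d(2) c(2)] by simp

context
  fixes M :: "('q, 'e::real_normed_vector) manifold" and c :: "('q, 'e) chart" and q :: 'q
  assumes M: "smooth_manifold M" and c: "c \<in> atlas M" "q \<in> fst c"
begin

lemma point_in_topspace: "q \<in> topspace (mtop M)"
  using M c by (auto simp: smooth_manifold_def)

lemma components_tangent_vector [simp]: "components M c q (tangent_vector M c q w) = w"
  unfolding components_def tangent_vector_def
  using fd_transition_inverse[OF M c chart_at_atlas[OF M point_in_topspace]] .

lemma tangent_vector_components [simp]: "tangent_vector M c q (components M c q v) = v"
  unfolding components_def tangent_vector_def
  using fd_transition_inverse[OF M chart_at_atlas[OF M point_in_topspace] c] .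

lemma linear_tangent_vector: "linear (tangent_vector M c q)"
  unfolding tangent_vector_def
  using linear_frechet_derivative[OF transition_differentiable[OF M c(1) chart_at_atlas(1)[OF M point_in_topspace]
    c(2) chart_at_atlas(2)[OF M point_in_topspace]]] .

lemma in_natural_coords_components:
  "in_natural_coords M c f (snd c q, components M c q v) = f (q, v)"
  using chart_inv_snd[OF smooth_manifold_chart[OF M c(1)] c(2)] by (simp add: in_natural_coords_def)

end

lemma components_chart_at:
  assumes "smooth_manifold M" "q \<in> topspace (mtop M)"
  shows "components M (chart_at M q) q v = v"
  unfolding components_def
  using fd_chart_id[OF smooth_manifold_chart chart_at_atlas(2)] chart_at_atlas assms by (metis id_apply)

text \<open>\<open>tangent_map\<close> lands in the reference chart at f q, which is unrelated to
  those of nearby points. Reading the result in a fixed chart c makes tangent maps with varying end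
  points comparable.\<close>

lemma components_tangent_map:
  assumes M: "smooth_manifold M" and c: "c \<in> atlas M" and a: "chart_at M (f q) \<in> atlas M"
    and W: "open W" "snd (chart_at N q) q \<in> W"
      "\<And>x. x \<in> W \<Longrightarrow> f (chart_inv (chart_at N q) x) \<in> fst c \<inter> fst (chart_at M (f q))"
    and inv: "chart_inv (chart_at N q) (snd (chart_at N q) q) = q"
    and h: "(snd c \<circ> f \<circ> chart_inv (chart_at N q)) differentiable (at (snd (chart_at N q) q))"
  shows "components M c (f q) (tangent_map N M f q v) =
    fd (snd c \<circ> f \<circ> chart_inv (chart_at N q)) (snd (chart_at N q) q) v"
proof -
  let ?b = "chart_at N q" and ?a = "chart_at M (f q)"
  have fq: "f q \<in> fst c" "f q \<in> fst ?a" using W(3)[OF W(2)] inv by auto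
  have h': "(snd c \<circ> (f \<circ> chart_inv ?b)) differentiable (at (snd ?b q))"
    using h by (simp add: comp_assoc)
  have O3: "\<And>x. x \<in> W \<Longrightarrow> (f \<circ> chart_inv ?b) x \<in> fst c \<inter> fst ?a" using W(3) by simp
  have "tangent_map N M f q v = fd (snd ?a \<circ> chart_inv c) (snd c (f q)) (fd (snd c \<circ> (f \<circ> chart_inv ?b)) (snd ?b q) v)"
    using fd_change_target(2)[OF M c a W(1,2) O3 h', of v] inv by (simp add: tangent_map_def comp_assoc)
  then show ?thesis
    unfolding components_def using fd_transition_inverse[OF M c fq(1) a fq(2)] by (simp add: comp_assoc)
qed

lemma partial_derivatives:
  assumes "f differentiable (at (a, b))"
  shows "((\<lambda>s. f (s, b)) has_derivative (\<lambda>k. fd f (a, b) (k, 0))) (at a)"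
    and "((\<lambda>s. f (a, s)) has_derivative (\<lambda>k. fd f (a, b) (0, k))) (at b)"
proof -
  have f: "(f has_derivative fd f (a, b)) (at (a, b))" using assms by (rule has_derivative_fd)
  have "((\<lambda>s. (s, b)) has_derivative (\<lambda>k. (k, 0))) (at a)" "((\<lambda>s. (a, s)) has_derivative (\<lambda>k. (0, k))) (at b)"
    by (auto intro!: derivative_eq_intros)
  with f show "((\<lambda>s. f (s, b)) has_derivative (\<lambda>k. fd f (a, b) (k, 0))) (at a)"
    "((\<lambda>s. f (a, s)) has_derivative (\<lambda>k. fd f (a, b) (0, k))) (at b)"
    by (auto intro: has_derivative_compose[where g = f])
qed

section \<open>Principal bundles with connection\<close>

locale principal_bundle =
  fixes G :: "('g, 'm) monoid_scheme"
    and GM :: "('g, 'l::real_normed_vector) manifold"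
    and Q :: "('q, 'e::real_normed_vector) manifold"
    and \<phi> :: "'g \<Rightarrow> 'q \<Rightarrow> 'q"
    and QG :: "('q set, 'b::real_normed_vector) manifold"
    and \<A> :: "'q \<times> 'e \<Rightarrow> 'l"
  assumes lie: "lie_group G GM"
    and Q: "smooth_manifold Q"
    and action: "smooth_action G GM Q \<phi>"
    and quotient: "quotient_manifold G Q \<phi> QG"
    and connection: "principal_connection G GM Q \<phi> \<A>"
begin

sublocale group_action G "topspace (mtop Q)" \<phi>
  using action by (simp add: smooth_action_def)

sublocale group G
  using lie by (simp add: lie_group_def)

abbreviation unit_chart where "unit_chart \<equiv> chart_at GM \<one>\<^bsub>G\<^esub>"
abbreviation unit_coord where "unit_coord \<equiv> snd unit_chart \<one>\<^bsub>G\<^esub>"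

lemma GM: "smooth_manifold GM" and carrier_topspace: "carrier G = topspace (mtop GM)"
  using lie by (auto simp: lie_group_def)

lemma QG: "smooth_manifold QG"
  using quotient by (simp add: quotient_manifold_def)

lemma orbit_topspace: "q \<in> topspace (mtop Q) \<Longrightarrow> orbit G \<phi> q \<in> topspace (mtop QG)"
  using quotient by (auto simp: quotient_manifold_def orbits_def)

lemma chart_point: "c \<in> atlas Q \<Longrightarrow> q \<in> fst c \<Longrightarrow> q \<in> topspace (mtop Q)"
  using point_in_topspace[OF Q] .

lemma action_one: "q \<in> topspace (mtop Q) \<Longrightarrow> \<phi> \<one>\<^bsub>G\<^esub> q = q"
  using id_eq_one by (metis restrict_apply')

lemma orbit_action:
  assumes g: "g \<in> carrier G" and q: "q \<in> topspace (mtop Q)"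
  shows "orbit G \<phi> (\<phi> g q) = orbit G \<phi> q"
proof
  show "orbit G \<phi> (\<phi> g q) \<subseteq> orbit G \<phi> q"
  proof
    fix r assume "r \<in> orbit G \<phi> (\<phi> g q)"
    then obtain h where h: "h \<in> carrier G" "r = \<phi> h (\<phi> g q)" by (auto simp: orbit_def)
    then have "r = \<phi> (h \<otimes>\<^bsub>G\<^esub> g) q" using composition_rule[OF q h(1) g] by simp
    then show "r \<in> orbit G \<phi> q" using g h by (auto simp: orbit_def)
  qed
  show "orbit G \<phi> q \<subseteq> orbit G \<phi> (\<phi> g q)"
  proof
    fix r assume "r \<in> orbit G \<phi> q"
    then obtain h where h: "h \<in> carrier G" "r = \<phi> h q" by (auto simp: orbit_def)
    have "r = \<phi> ((h \<otimes>\<^bsub>G\<^esub> inv\<^bsub>G\<^esub> g) \<otimes>\<^bsub>G\<^esub> g) q" using g h by (simp add: m_assoc)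
    also have "\<dots> = \<phi> (h \<otimes>\<^bsub>G\<^esub> inv\<^bsub>G\<^esub> g) (\<phi> g q)" using g h q by (intro composition_rule) auto
    finally show "r \<in> orbit G \<phi> (\<phi> g q)" using g h by (auto simp: orbit_def)
  qed
qed

lemma unit_chart: "unit_chart \<in> atlas GM" "\<one>\<^bsub>G\<^esub> \<in> fst unit_chart" "chart_inv unit_chart unit_coord = \<one>\<^bsub>G\<^esub>"
proof -
  have "\<one>\<^bsub>G\<^esub> \<in> topspace (mtop GM)" using carrier_topspace by auto
  from chart_at_atlas[OF GM this] show a: "unit_chart \<in> atlas GM" "\<one>\<^bsub>G\<^esub> \<in> fst unit_chart" .
  show "chart_inv unit_chart unit_coord = \<one>\<^bsub>G\<^esub>"
    using chart_inv_snd[OF smooth_manifold_chart[OF GM a(1)] a(2)] .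
qed

lemma chart_inv_carrier: "d \<in> atlas GM \<Longrightarrow> h \<in> snd d ` fst d \<Longrightarrow> chart_inv d h \<in> carrier G"
  using carrier_topspace point_in_topspace[OF GM _ chart_inv_in] by blast

lemma continuous_map_action: "continuous_map (prod_topology (mtop GM) (mtop Q)) (mtop Q) (\<lambda>(g, q). \<phi> g q)"
  using action by (simp add: smooth_action_def smooth_map_def prod_manifold_def)

lemma continuous_map_orbit_map:
  assumes "q \<in> topspace (mtop Q)" shows "continuous_map (mtop GM) (mtop Q) (\<lambda>g. \<phi> g q)"
proof -
  have "continuous_map (mtop GM) (prod_topology (mtop GM) (mtop Q)) (\<lambda>g. (g, q))"
    using assms by (intro continuous_map_pairedI) auto
  from continuous_map_compose[OF this continuous_map_action] show ?thesis by (simp add: o_def)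
qed

lemma continuous_map_translation:
  assumes "g \<in> carrier G" shows "continuous_map (mtop Q) (mtop Q) (\<phi> g)"
proof -
  have "continuous_map (mtop Q) (prod_topology (mtop GM) (mtop Q)) (\<lambda>q. (g, q))"
    using assms carrier_topspace by (intro continuous_map_pairedI) auto
  from continuous_map_compose[OF this continuous_map_action] show ?thesis by (simp add: o_def)
qed

section \<open>The action and its lift in charts\<close>

text \<open>One map on a product space, so that fundamental fields and lifted translations are its
  derivatives in the directions (\<xi>, 0) and (0, v) and can be interchanged. The same chart c
  serves source and target, which makes the map the identity in the second variable at the
  unit.\<close>

definition action_chart :: "('g, 'l) chart \<Rightarrow> ('q, 'e) chart \<Rightarrow> 'l \<times> 'e \<Rightarrow> 'e" where
  "action_chart d c = (\<lambda>z. snd c (\<phi> (chart_inv d (fst z)) (chart_inv c (snd z))))"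

definition action_dom :: "('g, 'l) chart \<Rightarrow> ('q, 'e) chart \<Rightarrow> ('l \<times> 'e) set" where
  "action_dom d c = {z \<in> (snd d ` fst d) \<times> (snd c ` fst c). \<phi> (chart_inv d (fst z)) (chart_inv c (snd z)) \<in> fst c}"

context
  fixes d :: "('g, 'l) chart" and c :: "('q, 'e) chart"
  assumes d: "d \<in> atlas GM" and c: "c \<in> atlas Q"
begin

lemma ch: "is_chart (mtop GM) d" "is_chart (mtop Q) c"
  using smooth_manifold_chart[OF GM d] smooth_manifold_chart[OF Q c] .

lemma open_action_dom: "open (action_dom d c)"
proof -
  let ?X = "top_of_set ((snd d ` fst d) \<times> (snd c ` fst c))"
  have fs: "continuous_map ?X (top_of_set (snd d ` fst d)) fst" "continuous_map ?X (top_of_set (snd c ` fst c)) snd"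
    by (auto simp: continuous_map_in_subtopology continuous_on_fst continuous_on_snd)
  have "continuous_map ?X (prod_topology (mtop GM) (mtop Q)) (\<lambda>z. (chart_inv d (fst z), chart_inv c (snd z)))"
    using continuous_map_compose[OF fs(1) continuous_map_chart_inv[OF ch(1)]]
      continuous_map_compose[OF fs(2) continuous_map_chart_inv[OF ch(2)]]
    by (intro continuous_map_pairedI) (simp_all add: o_def)
  from continuous_map_compose[OF this continuous_map_action]
  have "continuous_map ?X (mtop Q) (\<lambda>z. \<phi> (chart_inv d (fst z)) (chart_inv c (snd z)))" by (simp add: o_def)
  moreover have "openin (mtop Q) (fst c)" using ch(2) by (simp add: is_chart_def)
  ultimately have "openin ?X {z \<in> topspace ?X. \<phi> (chart_inv d (fst z)) (chart_inv c (snd z)) \<in> fst c}"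
    by (rule openin_continuous_map_preimage)
  moreover have "open ((snd d ` fst d) \<times> (snd c ` fst c))" using ch by (simp add: is_chart_def open_Times)
  ultimately show ?thesis by (simp add: action_dom_def openin_open_eq)
qed

lemma smooth_action_chart: "smooth_on (action_chart d c) (action_dom d c)"
proof -
  define dc where "dc = (fst d \<times> fst c, map_prod (snd d) (snd c))"
  have inj: "inj_on (map_prod (snd d) (snd c)) (fst d \<times> fst c)"
    using is_chart_inj[OF ch(1)] is_chart_inj[OF ch(2)] by (rule map_prod_inj_on)
  then have inv: "chart_inv dc (snd d g, snd c q) = (g, q)" if "g \<in> fst d" "q \<in> fst c" for g q
    using inv_into_f_f[OF inj, of "(g, q)"] that by (simp add: chart_inv_def dc_def)
  have "\<exists>c' d'. dc = (fst c' \<times> fst d', map_prod (snd c') (snd d')) \<and> c' \<in> atlas GM \<and> d' \<in> atlas Q"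
    using d c dc_def by blast
  then have dc: "dc \<in> atlas (prod_manifold GM Q)" by (simp add: prod_manifold_def)
  have "smooth_map (prod_manifold GM Q) Q (\<lambda>(g, q). \<phi> g q)" using action by (simp add: smooth_action_def)
  then have sm: "smooth_on (snd c \<circ> (\<lambda>(g, q). \<phi> g q) \<circ> chart_inv dc) (snd dc ` {z \<in> fst dc. (\<lambda>(g, q). \<phi> g q) z \<in> fst c})"
    using dc c unfolding smooth_map_def by blast
  have dom: "snd dc ` {z \<in> fst dc. (\<lambda>(g, q). \<phi> g q) z \<in> fst c} = action_dom d c"
  proof (intro equalityI subsetI)
    fix z assume "z \<in> snd dc ` {z \<in> fst dc. (\<lambda>(g, q). \<phi> g q) z \<in> fst c}"
    then obtain g q where "g \<in> fst d" "q \<in> fst c" "\<phi> g q \<in> fst c" "z = (snd d g, snd c q)"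
      by (auto simp: dc_def)
    then show "z \<in> action_dom d c"
      by (simp add: action_dom_def chart_inv_snd[OF ch(1)] chart_inv_snd[OF ch(2)])
  next
    fix z assume "z \<in> action_dom d c"
    then obtain g q where z: "g \<in> fst d" "q \<in> fst c" "z = (snd d g, snd c q)" "\<phi> g q \<in> fst c"
      by (auto simp: action_dom_def chart_inv_snd[OF ch(1)] chart_inv_snd[OF ch(2)])
    then show "z \<in> snd dc ` {z \<in> fst dc. (\<lambda>(g, q). \<phi> g q) z \<in> fst c}"
      by (intro image_eqI[of _ _ "(g, q)"]) (simp_all add: dc_def)
  qed
  show ?thesis
  proof (rule smooth_on_cong_open[OF sm[unfolded dom] open_action_dom])
    fix z assume "z \<in> action_dom d c"
    then obtain g q where z: "g \<in> fst d" "q \<in> fst c" "z = (snd d g, snd c q)" by (auto simp: action_dom_def)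
    then show "(snd c \<circ> (\<lambda>(g, q). \<phi> g q) \<circ> chart_inv dc) z = action_chart d c z"
      using inv chart_inv_snd[OF ch(1)] chart_inv_snd[OF ch(2)] by (simp add: action_chart_def)
  qed
qed

lemma action_chart_differentiable: "z \<in> action_dom d c \<Longrightarrow> action_chart d c differentiable (at z)"
  using smooth_on_differentiable[OF smooth_action_chart] .

end

lemma unit_action_dom:
  assumes c: "c \<in> atlas Q" and x: "x \<in> snd c ` fst c"
  shows "(unit_coord, x) \<in> action_dom unit_chart c" "action_chart unit_chart c (unit_coord, x) = x"
  using x unit_chart action_one chart_inv_in[OF x] chart_point[OF c] snd_chart_inv[OF x]
  by (auto simp: action_dom_def action_chart_def)

lemma components_fundamental_field:
  assumes c: "c \<in> atlas Q" "q \<in> fst c"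
  shows "components Q c q (fundamental_field G GM Q \<phi> \<xi> q) = fd (action_chart unit_chart c) (unit_coord, snd c q) (\<xi>, 0)"
proof -
  have q: "q \<in> topspace (mtop Q)" using chart_point c by blast
  have one: "\<phi> \<one>\<^bsub>G\<^esub> q = q" using action_one[OF q] .
  let ?a = "chart_at Q (\<phi> \<one>\<^bsub>G\<^esub> q)"
  have a: "?a \<in> atlas Q" "q \<in> fst ?a" using chart_at_atlas[OF Q q] one by auto
  let ?W = "{h \<in> snd unit_chart ` fst unit_chart. \<phi> (chart_inv unit_chart h) q \<in> fst c \<inter> fst ?a}"
  have W: "open ?W"
    using smooth_manifold_chart[OF Q a(1)] smooth_manifold_chart[OF Q c(1)]
    by (intro open_chart_preimage[OF smooth_manifold_chart[OF GM unit_chart(1)] continuous_map_orbit_map[OF q]])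
       (auto simp: is_chart_def)
  have qc: "chart_inv c (snd c q) = q" using chart_inv_snd[OF smooth_manifold_chart[OF Q c(1)] c(2)] .
  have eq: "snd c \<circ> (\<lambda>g. \<phi> g q) \<circ> chart_inv unit_chart = (\<lambda>h. action_chart unit_chart c (h, snd c q))"
    by (auto simp: action_chart_def qc)
  have der: "((\<lambda>h. action_chart unit_chart c (h, snd c q)) has_derivative
      (\<lambda>k. fd (action_chart unit_chart c) (unit_coord, snd c q) (k, 0))) (at unit_coord)"
    by (intro partial_derivatives action_chart_differentiable[OF unit_chart(1) c(1)] unit_action_dom[OF c(1)]) (use c in auto)
  have "components Q c (\<phi> \<one>\<^bsub>G\<^esub> q) (tangent_map GM Q (\<lambda>g. \<phi> g q) \<one>\<^bsub>G\<^esub> \<xi>) =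
    fd (snd c \<circ> (\<lambda>g. \<phi> g q) \<circ> chart_inv unit_chart) unit_coord \<xi>"
  proof (rule components_tangent_map[where f = "\<lambda>g. \<phi> g q" and q = "\<one>\<^bsub>G\<^esub>", OF Q c(1) a(1) W])
    show "unit_coord \<in> ?W" using unit_chart c a one by auto
    show "(snd c \<circ> (\<lambda>g. \<phi> g q) \<circ> chart_inv unit_chart) differentiable at unit_coord"
      unfolding eq using der by (rule differentiableI)
  qed (use unit_chart in auto)
  then show ?thesis unfolding one eq fd_eqI[OF der] by (simp add: fundamental_field_def)
qed

lemma vf_in_fundamental_field:
  assumes "c \<in> atlas Q" "x \<in> snd c ` fst c"
  shows "vf_in Q c (fundamental_field G GM Q \<phi> \<xi>) x = fd (action_chart unit_chart c) (unit_coord, x) (\<xi>, 0)"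
  using components_fundamental_field[OF assms(1) chart_inv_in[OF assms(2)]] snd_chart_inv[OF assms(2)]
  by (simp add: vf_in_def)

text \<open>As long as the translated point stays in the reference chart of q, the lifted action is
  a partial derivative of \<open>action_chart\<close> and thus depends differentiably on the group
  coordinate h.\<close>

lemma components_tangent_translation:
  assumes q: "q \<in> topspace (mtop Q)" and c: "c = chart_at Q q" and d: "d \<in> atlas GM"
    and h: "(h, snd c q) \<in> action_dom d c"
  shows "components Q c (\<phi> (chart_inv d h) q) (tangent_map Q Q (\<phi> (chart_inv d h)) q v)
    = fd (action_chart d c) (h, snd c q) (0, v)"
proof -
  let ?g = "chart_inv d h"
  have cq: "c \<in> atlas Q" "q \<in> fst c" using chart_at_atlas[OF Q q] c by auto
  have qc: "chart_inv c (snd c q) = q" using chart_inv_snd[OF smooth_manifold_chart[OF Q cq(1)] cq(2)] .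
  have g: "?g \<in> carrier G" using h d chart_inv_carrier by (auto simp: action_dom_def)
  have gq: "\<phi> ?g q \<in> fst c" "\<phi> ?g q \<in> topspace (mtop Q)"
    using h qc chart_point[OF cq(1)] by (auto simp: action_dom_def)
  let ?a = "chart_at Q (\<phi> ?g q)"
  have a: "?a \<in> atlas Q" "\<phi> ?g q \<in> fst ?a" using chart_at_atlas[OF Q gq(2)] by auto
  let ?W = "{x \<in> snd c ` fst c. \<phi> ?g (chart_inv c x) \<in> fst c \<inter> fst ?a}"
  have W: "open ?W"
    using smooth_manifold_chart[OF Q a(1)] smooth_manifold_chart[OF Q cq(1)]
    by (intro open_chart_preimage[OF smooth_manifold_chart[OF Q cq(1)] continuous_map_translation[OF g]])
       (auto simp: is_chart_def)
  have eq: "snd c \<circ> \<phi> ?g \<circ> chart_inv c = (\<lambda>x. action_chart d c (h, x))"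
    by (auto simp: action_chart_def)
  have der: "((\<lambda>x. action_chart d c (h, x)) has_derivative
      (\<lambda>k. fd (action_chart d c) (h, snd c q) (0, k))) (at (snd c q))"
    by (intro partial_derivatives action_chart_differentiable[OF d cq(1)] h)
  have "components Q c (\<phi> ?g q) (tangent_map Q Q (\<phi> ?g) q v) = fd (snd c \<circ> \<phi> ?g \<circ> chart_inv (chart_at Q q)) (snd (chart_at Q q) q) v"
  proof (rule components_tangent_map[where f = "\<phi> ?g" and q = q, OF Q cq(1) a(1) W])
    show "snd (chart_at Q q) q \<in> ?W" using cq gq a c qc by auto
    show "(snd c \<circ> \<phi> ?g \<circ> chart_inv (chart_at Q q)) differentiable at (snd (chart_at Q q) q)"
      using der unfolding c[symmetric] eq by (rule differentiableI)
  qed (use qc c in auto)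
  then show ?thesis unfolding c[symmetric] eq fd_eqI[OF der] .
qed

text \<open>The flow of \<open>\<xi>\<^sub>Q\<close> on the tangent bundle is the lifted action; the symmetry of the mixed
  derivative of the action identifies its generator with the complete lift of \<open>\<xi>\<^sub>Q\<close>.\<close>

lemma invariant_complete_lift:
  fixes f :: "'q \<times> 'e \<Rightarrow> 'f::real_normed_vector" and \<xi> :: 'l
  assumes f: "smooth_on_tangent_bundle Q f" and q: "q \<in> topspace (mtop Q)"
    and inv: "\<And>h. (h, snd (chart_at Q q) q) \<in> action_dom unit_chart (chart_at Q q) \<Longrightarrow>
      f (\<phi> (chart_inv unit_chart h) q, tangent_map Q Q (\<phi> (chart_inv unit_chart h)) q v) = f (q, v)"
  defines "c \<equiv> chart_at Q q" and "E \<equiv> vf_in Q (chart_at Q q) (fundamental_field G GM Q \<phi> \<xi>)"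
  shows "fd (in_natural_coords Q c f) (snd c q, v) (E (snd c q), fd E (snd c q) v) = 0"
proof -
  define x where "x = snd c q"
  define \<Psi> where "\<Psi> = action_chart unit_chart c"
  define fc where "fc = in_natural_coords Q c f"
  have c: "c \<in> atlas Q" "q \<in> fst c" using chart_at_atlas[OF Q q] c_def by auto
  have x: "x \<in> snd c ` fst c" using c x_def by auto
  have qc: "chart_inv c x = q" using chart_inv_snd[OF smooth_manifold_chart[OF Q c(1)] c(2)] x_def by simp
  note dom = unit_action_dom[OF c(1) x] and smooth = smooth_action_chart[OF unit_chart(1) c(1)]
  note odom = open_action_dom[OF unit_chart(1) c(1)]
  have \<Psi>: "\<Psi> differentiable (at z)" if "z \<in> action_dom unit_chart c" for z
    using smooth_on_differentiable[OF smooth that] by (simp add: \<Psi>_def)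
  have d\<Psi>: "(\<lambda>z. fd \<Psi> z w) differentiable (at z)" if "z \<in> action_dom unit_chart c" for z w
    using smooth_on_differentiable[OF smooth_on_fd[OF smooth] that] by (simp add: \<Psi>_def)
  have E: "E y = fd \<Psi> (unit_coord, y) (\<xi>, 0)" if "y \<in> snd c ` fst c" for y
    using vf_in_fundamental_field[OF c(1) that] by (simp add: E_def c_def \<Psi>_def)
  have oc: "open (snd c ` fst c)" using smooth_manifold_chart[OF Q c(1)] by (simp add: is_chart_def)
  have fdE: "fd E x v = fd (\<lambda>z. fd \<Psi> z (\<xi>, 0)) (unit_coord, x) (0, v)"
  proof -
    have "fd E x = fd (\<lambda>y. fd \<Psi> (unit_coord, y) (\<xi>, 0)) x" by (rule fd_cong_open[OF oc x E])
    also have "\<dots> = (\<lambda>k. fd (\<lambda>z. fd \<Psi> z (\<xi>, 0)) (unit_coord, x) (0, k))"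
      by (rule fd_eqI[OF partial_derivatives(2)[OF d\<Psi>[OF dom(1)]]])
    finally show ?thesis by simp
  qed
  have sym: "fd (\<lambda>z. fd \<Psi> z (0, v)) (unit_coord, x) (\<xi>, 0) = fd E x v"
    unfolding fdE by (rule fd_symmetric[OF odom dom(1) \<Psi> d\<Psi>[OF dom(1)] d\<Psi>[OF dom(1)]])
  have id: "fd \<Psi> (unit_coord, x) (0, v) = v"
  proof -
    have "(\<lambda>k. fd \<Psi> (unit_coord, x) (0, k)) = fd (\<lambda>y. \<Psi> (unit_coord, y)) x"
      by (rule fd_eqI[OF partial_derivatives(2)[OF \<Psi>[OF dom(1)]], symmetric])
    also have "\<dots> = fd (\<lambda>y. y) x"
      by (rule fd_cong_open[OF oc x]) (simp add: \<Psi>_def unit_action_dom[OF c(1)])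
    finally show ?thesis by (simp add: fun_eq_iff)
  qed
  define W where "W = {h. (h, x) \<in> action_dom unit_chart c}"
  have "W = (\<lambda>h. (h, x)) -` action_dom unit_chart c" by (auto simp: W_def)
  then have W: "open W" "unit_coord \<in> W"
    using open_vimage[OF odom, of "\<lambda>h. (h, x)"] dom(1)
    by (simp_all add: continuous_on_Pair continuous_on_id continuous_on_const)
  \<comment> \<open>The lifted action on (q, v) in natural coordinates, starting at (x, v) by
    \<open>id\<close>. Its second component moves with velocity \<open>fd E x v\<close> by
    \<open>sym\<close>.\<close>
  define \<gamma> where "\<gamma> = (\<lambda>h. (\<Psi> (h, x), fd \<Psi> (h, x) (0, v)))"
  have const: "fc (\<gamma> h) = f (q, v)" if "h \<in> W" for h
  proof -
    let ?g = "chart_inv unit_chart h"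
    have h: "(h, x) \<in> action_dom unit_chart c" using that W_def by simp
    have g: "?g \<in> carrier G" "\<phi> ?g q \<in> fst c" "\<Psi> (h, x) = snd c (\<phi> ?g q)"
      using h chart_inv_carrier[OF unit_chart(1)] qc by (auto simp: action_dom_def \<Psi>_def action_chart_def)
    have "components Q c (\<phi> ?g q) (tangent_map Q Q (\<phi> ?g) q v) = fd \<Psi> (h, x) (0, v)"
      using components_tangent_translation[OF q c_def[THEN meta_eq_to_obj_eq] unit_chart(1), of h v] h
      by (simp add: \<Psi>_def x_def)
    then have "fc (\<gamma> h) = f (\<phi> ?g q, tangent_map Q Q (\<phi> ?g) q v)"
      using in_natural_coords_components[OF Q c(1) g(2), of f "tangent_map Q Q (\<phi> ?g) q v"] g(3)
      by (simp add: fc_def \<gamma>_def)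
    then show ?thesis using inv[of h] h by (simp add: x_def c_def)
  qed
  have \<gamma>0: "\<gamma> unit_coord = (x, v)" using dom(2) id by (simp add: \<gamma>_def \<Psi>_def)
  have "(\<gamma> has_derivative (\<lambda>k. (fd \<Psi> (unit_coord, x) (k, 0), fd (\<lambda>z. fd \<Psi> z (0, v)) (unit_coord, x) (k, 0)))) (at unit_coord)"
    unfolding \<gamma>_def
    by (intro has_derivative_Pair partial_derivatives \<Psi> dom d\<Psi>)
  moreover have "(fc has_derivative fd fc (x, v)) (at (\<gamma> unit_coord))"
  proof -
    have "smooth_on fc ((snd c ` fst c) \<times> UNIV)"
      using f c(1) by (simp add: smooth_on_tangent_bundle_def fc_def)
    from smooth_on_differentiable[OF this, of "(x, v)"] x show ?thesis
      unfolding \<gamma>0 by (intro has_derivative_fd) auto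
  qed
  ultimately have "((\<lambda>h. fc (\<gamma> h)) has_derivative
      (\<lambda>k. fd fc (x, v) (fd \<Psi> (unit_coord, x) (k, 0), fd (\<lambda>z. fd \<Psi> z (0, v)) (unit_coord, x) (k, 0)))) (at unit_coord)"
    by (rule has_derivative_compose)
  then have "fd (\<lambda>h. fc (\<gamma> h)) unit_coord \<xi> =
      fd fc (x, v) (fd \<Psi> (unit_coord, x) (\<xi>, 0), fd (\<lambda>z. fd \<Psi> z (0, v)) (unit_coord, x) (\<xi>, 0))"
    by (simp add: fd_eqI)
  moreover have "fd (\<lambda>h. fc (\<gamma> h)) unit_coord = fd (\<lambda>h. f (q, v)) unit_coord"
    by (rule fd_cong_open[OF W const])
  ultimately have "fd fc (x, v) (E x, fd E x v) = 0" by (simp add: sym E[OF x])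
  then show ?thesis by (simp add: x_def fc_def)
qed

end

text \<open>Second countability implies the Lindelof property. For the group this makes the covering
  of an orbit by chart images countable, as a negligibility argument requires.\<close>

lemma countable_subatlas:
  assumes M: "smooth_manifold M"
  obtains \<D> where "\<D> \<subseteq> atlas M" "countable \<D>" "topspace (mtop M) \<subseteq> (\<Union>d\<in>\<D>. fst d)"
proof -
  have L: "Lindelof_space (mtop M)"
    using M by (intro second_countable_imp_Lindelof_space) (simp add: smooth_manifold_def)
  have op: "openin (mtop M) U" if "U \<in> fst ` atlas M" for U
    using that smooth_manifold_chart[OF M] by (auto simp: is_chart_def)
  have un: "\<Union> (fst ` atlas M) = topspace (mtop M)"
    using M by (simp add: smooth_manifold_def)
  have "\<exists>\<V>. countable \<V> \<and> \<V> \<subseteq> fst ` atlas M \<and> \<Union> \<V> = topspace (mtop M)"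
    by (rule Lindelof_spaceD[OF L _ un]) (rule op)
  then obtain \<V> where \<V>: "countable \<V>" "\<V> \<subseteq> fst ` atlas M" "\<Union> \<V> = topspace (mtop M)"
    by (elim exE conjE)
  then have "\<exists>\<D>. countable \<D> \<and> \<D> \<subseteq> atlas M \<and> \<V> = fst ` \<D>"
    by (intro iffD1[OF countable_subset_image] conjI)
  then obtain \<D> where "countable \<D>" "\<D> \<subseteq> atlas M" "\<V> = fst ` \<D>" by (elim exE conjE)
  then show thesis using that[of \<D>] \<V>(3) by simp
qed

context principal_bundle
begin

section \<open>The projection, the connection form and horizontal lifts in charts\<close>

definition proj_chart :: "('q, 'e) chart \<Rightarrow> ('q set, 'b) chart \<Rightarrow> 'e \<Rightarrow> 'b" where
  "proj_chart c \<kappa> = snd \<kappa> \<circ> orbit G \<phi> \<circ> chart_inv c"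

definition proj_dom :: "('q, 'e) chart \<Rightarrow> ('q set, 'b) chart \<Rightarrow> 'e set" where
  "proj_dom c \<kappa> = {x \<in> snd c ` fst c. orbit G \<phi> (chart_inv c x) \<in> fst \<kappa>}"

definition conn_chart :: "('q, 'e) chart \<Rightarrow> 'e \<Rightarrow> 'e \<Rightarrow> 'l" where
  "conn_chart c x w = in_natural_coords Q c \<A> (x, w)"

lemma continuous_map_orbit: "continuous_map (mtop Q) (mtop QG) (orbit G \<phi>)"
  using quotient by (simp add: quotient_manifold_def smooth_map_def)

lemma components_eq_conn_chart:
  assumes "c \<in> atlas Q" "q \<in> fst c"
  shows "conn_chart c (snd c q) (components Q c q v) = \<A> (q, v)"
  unfolding conn_chart_def using in_natural_coords_components[OF Q assms] .

lemma connection_linear: "q \<in> topspace (mtop Q) \<Longrightarrow> linear (\<lambda>v. \<A> (q, v))"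
  and connection_fundamental_field: "q \<in> topspace (mtop Q) \<Longrightarrow> \<A> (q, fundamental_field G GM Q \<phi> \<xi> q) = \<xi>"
  and connection_equivariant: "q \<in> topspace (mtop Q) \<Longrightarrow> g \<in> carrier G \<Longrightarrow>
    \<A> (\<phi> g q, tangent_map Q Q (\<phi> g) q v) = Ad G GM g (\<A> (q, v))"
  and connection_smooth: "smooth_on_tangent_bundle Q \<A>"
  using connection by (auto simp: principal_connection_def)

lemma conn_chart_linear:
  assumes c: "c \<in> atlas Q" and x: "x \<in> snd c ` fst c" shows "linear (conn_chart c x)"
proof -
  obtain q where q: "q \<in> fst c" "x = snd c q" using x by auto
  have "conn_chart c x = (\<lambda>w. \<A> (q, tangent_vector Q c q w))"
    using q chart_inv_snd[OF smooth_manifold_chart[OF Q c] q(1)] by (auto simp: conn_chart_def in_natural_coords_def)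
  then show ?thesis
    using linear_compose[OF linear_tangent_vector[OF Q c q(1)] connection_linear[OF chart_point[OF c q(1)]]]
    by (simp add: o_def)
qed

lemma conn_chart_differentiable:
  assumes c: "c \<in> atlas Q" and x: "x \<in> snd c ` fst c"
  shows "(\<lambda>x. conn_chart c x w) differentiable (at x)"
proof -
  have "in_natural_coords Q c \<A> differentiable (at (x, w))"
    using connection_smooth c x
    by (intro smooth_on_differentiable[of _ "(snd c ` fst c) \<times> UNIV"]) (auto simp: smooth_on_tangent_bundle_def)
  from partial_derivatives(1)[OF this] show ?thesis unfolding conn_chart_def by (rule differentiableI)
qed

context
  fixes c :: "('q, 'e) chart" and \<kappa> :: "('q set, 'b) chart"
  assumes c: "c \<in> atlas Q" and \<kappa>: "\<kappa> \<in> atlas QG"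
begin

lemma open_proj_dom: "open (proj_dom c \<kappa>)"
  unfolding proj_dom_def
  using smooth_manifold_chart[OF QG \<kappa>]
  by (intro open_chart_preimage[OF smooth_manifold_chart[OF Q c] continuous_map_orbit]) (simp add: is_chart_def)

lemma proj_dom_point:
  assumes "q \<in> fst c" "orbit G \<phi> q \<in> fst \<kappa>" shows "snd c q \<in> proj_dom c \<kappa>"
  using assms chart_inv_snd[OF smooth_manifold_chart[OF Q c]] by (simp add: proj_dom_def)

lemma smooth_proj_chart: "smooth_on (proj_chart c \<kappa>) (proj_dom c \<kappa>)"
proof -
  have "smooth_on (snd \<kappa> \<circ> orbit G \<phi> \<circ> chart_inv c) (snd c ` {q \<in> fst c. orbit G \<phi> q \<in> fst \<kappa>})"
    using quotient c \<kappa> by (simp add: quotient_manifold_def smooth_map_def)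
  then show ?thesis
    by (simp add: proj_chart_def proj_dom_def chart_image_Collect[OF smooth_manifold_chart[OF Q c]])
qed

lemma proj_chart_differentiable: "x \<in> proj_dom c \<kappa> \<Longrightarrow> proj_chart c \<kappa> differentiable (at x)"
  using smooth_on_differentiable[OF smooth_proj_chart] .

end

text \<open>The definition of \<open>tangent_map\<close> involves reference charts at both ends;
  \<open>components_tangent_map\<close> replaces the target chart and
  \<open>fd_change_source\<close> the source chart.\<close>

lemma components_tangent_projection:
  assumes c: "c \<in> atlas Q" "q \<in> fst c" and \<kappa>: "\<kappa> \<in> atlas QG" "orbit G \<phi> q \<in> fst \<kappa>"
  shows "components QG \<kappa> (orbit G \<phi> q) (tangent_map Q QG (orbit G \<phi>) q v)
    = fd (proj_chart c \<kappa>) (snd c q) (components Q c q v)"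
proof -
  have q: "q \<in> topspace (mtop Q)" using chart_point c by blast
  let ?b = "chart_at Q q" and ?a = "chart_at QG (orbit G \<phi> q)"
  have b: "?b \<in> atlas Q" "q \<in> fst ?b" using chart_at_atlas[OF Q q] .
  have a: "?a \<in> atlas QG" "orbit G \<phi> q \<in> fst ?a" using chart_at_atlas[OF QG orbit_topspace[OF q]] .
  have qb: "chart_inv ?b (snd ?b q) = q" using chart_inv_snd[OF smooth_manifold_chart[OF Q b(1)] b(2)] .
  have d: "(snd \<kappa> \<circ> orbit G \<phi> \<circ> chart_inv c') differentiable (at (snd c' q))" if "c' \<in> atlas Q" "q \<in> fst c'" for c'
    using proj_chart_differentiable[OF that(1) \<kappa>(1) proj_dom_point[OF that(1) \<kappa>(1) that(2) \<kappa>(2)]]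
    by (simp add: proj_chart_def)
  have "components QG \<kappa> (orbit G \<phi> q) (tangent_map Q QG (orbit G \<phi>) q v) =
    fd (snd \<kappa> \<circ> orbit G \<phi> \<circ> chart_inv ?b) (snd ?b q) v"
  proof (rule components_tangent_map[where f = "orbit G \<phi>" and q = q, OF QG \<kappa>(1) a(1)
        open_Int[OF open_proj_dom[OF b(1) \<kappa>(1)] open_proj_dom[OF b(1) a(1)]]])
    show "snd ?b q \<in> proj_dom ?b \<kappa> \<inter> proj_dom ?b ?a"
      using proj_dom_point[OF b(1)] \<kappa> a b by blast
  qed (use qb d b in \<open>auto simp: proj_dom_def\<close>)
  also have "\<dots> = fd (snd \<kappa> \<circ> orbit G \<phi> \<circ> chart_inv c) (snd c q) (fd (snd c \<circ> chart_inv ?b) (snd ?b q) v)"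
    using fd_change_source(2)[OF Q b c, of "snd \<kappa> \<circ> orbit G \<phi>" v] d[OF c] by simp
  finally show ?thesis by (simp add: proj_chart_def components_def)
qed

text \<open>The kernel of the tangent map of the projection is exhausted by the fundamental fields because
  the orbit, the image of a second countable manifold, would otherwise be negligible in the fibre.\<close>

lemma frame_bij:
  assumes c: "c \<in> atlas Q" and \<kappa>: "\<kappa> \<in> atlas QG" and x: "x \<in> proj_dom c \<kappa>"
  shows "bij (\<lambda>w. (fd (proj_chart c \<kappa>) x w, conn_chart c x w))"
    and "fd (proj_chart c \<kappa>) x (vf_in Q c (fundamental_field G GM Q \<phi> \<xi>) x) = 0"
    and "conn_chart c x (vf_in Q c (fundamental_field G GM Q \<phi> \<xi>) x) = \<xi>"
proof -
  let ?F = "proj_chart c \<kappa>" and ?E = "\<lambda>\<xi>. vf_in Q c (fundamental_field G GM Q \<phi> \<xi>) x"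
  have xc: "x \<in> snd c ` fst c" using x by (simp add: proj_dom_def)
  obtain q where q: "q \<in> fst c" "x = snd c q" using xc by auto
  have qt: "q \<in> topspace (mtop Q)" using chart_point c q by blast
  have qc: "chart_inv c x = q" using chart_inv_snd[OF smooth_manifold_chart[OF Q c]] q by simp
  have \<pi>q: "orbit G \<phi> q \<in> fst \<kappa>" using x qc by (simp add: proj_dom_def)
  have linF: "linear (fd ?F x)"
    using linear_frechet_derivative[OF proj_chart_differentiable[OF c \<kappa> x]] .
  note linA = conn_chart_linear[OF c xc]
  show AE: "conn_chart c x (?E \<xi>) = \<xi>" for \<xi>
    using components_eq_conn_chart[OF c q(1)] connection_fundamental_field[OF qt] q qc by (simp add: vf_in_def)
  show FE: "fd ?F x (?E \<xi>) = 0" for \<xi>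
  proof -
    let ?\<Psi> = "action_chart unit_chart c"
    note dom = unit_action_dom[OF c xc]
    have \<gamma>: "((\<lambda>h. ?\<Psi> (h, x)) has_derivative (\<lambda>k. fd ?\<Psi> (unit_coord, x) (k, 0))) (at unit_coord)"
      by (intro partial_derivatives action_chart_differentiable unit_chart c dom)
    have "(?F has_derivative fd ?F x) (at (?\<Psi> (unit_coord, x)))"
      using has_derivative_fd[OF proj_chart_differentiable[OF c \<kappa> x]] dom(2) by simp
    from fd_eqI[OF has_derivative_compose[OF \<gamma> this]]
    have "fd (\<lambda>h. ?F (?\<Psi> (h, x))) unit_coord \<xi> = fd ?F x (?E \<xi>)"
      using vf_in_fundamental_field[OF c xc] by simp
    \<comment> \<open>Points of one orbit have the same projection, so ?F is constant along the
      orbit map.\<close>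
    moreover have "fd (\<lambda>h. ?F (?\<Psi> (h, x))) unit_coord = fd (\<lambda>h. ?F x) unit_coord"
    proof (rule fd_cong_open)
      show "open ((\<lambda>h. (h, x)) -` action_dom unit_chart c)"
        by (intro open_vimage open_action_dom unit_chart c) (simp add: continuous_on_Pair)
      show "unit_coord \<in> (\<lambda>h. (h, x)) -` action_dom unit_chart c" using dom by simp
      fix h assume "h \<in> (\<lambda>h. (h, x)) -` action_dom unit_chart c"
      then have "chart_inv unit_chart h \<in> carrier G" "\<phi> (chart_inv unit_chart h) q \<in> fst c"
        using chart_inv_carrier[OF unit_chart(1)] qc by (auto simp: action_dom_def)
      then show "?F (?\<Psi> (h, x)) = ?F x"
        using chart_inv_snd[OF smooth_manifold_chart[OF Q c]] orbit_action[OF _ qt] qc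
        by (simp add: proj_chart_def action_chart_def)
    qed
    ultimately show ?thesis by simp
  qed
  have surjF: "\<exists>w. fd ?F x w = y" for y
  proof -
    obtain u where u: "tangent_map Q QG (orbit G \<phi>) q u = tangent_vector QG \<kappa> (orbit G \<phi> q) y"
      using quotient qt unfolding quotient_manifold_def by (metis UNIV_I imageE)
    have "fd ?F x (components Q c q u) = y"
      using components_tangent_projection[OF c q(1) \<kappa> \<pi>q, of u] u components_tangent_vector[OF QG \<kappa> \<pi>q] q(2) by simp
    then show ?thesis by blast
  qed
  have surj: "surj (\<lambda>w. (fd ?F x w, conn_chart c x w))"
  proof -
    have "\<exists>w. (y, \<xi>) = (fd ?F x w, conn_chart c x w)" for y \<xi>
    proof -
      obtain w where w: "fd ?F x w = y" using surjF by blast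
      show ?thesis
        \<comment> \<open>A fundamental field corrects the connection component without changing the
          projection.\<close>
        by (rule exI[of _ "w + ?E (\<xi> - conn_chart c x w)"])
           (simp add: w linear_add[OF linF] linear_add[OF linA] AE FE)
    qed
    then show ?thesis unfolding surj_def by auto
  qed
  obtain \<D> where \<D>: "\<D> \<subseteq> atlas GM" "countable \<D>" "carrier G \<subseteq> (\<Union>d\<in>\<D>. fst d)"
    using countable_subatlas[OF GM] carrier_topspace by metis
  obtain S :: "'e set" where S: "is_basis S" using Q by (auto simp: smooth_manifold_def)
  obtain SB :: "'b set" where SB: "is_basis SB" using QG by (auto simp: smooth_manifold_def)
  have "inj (\<lambda>w. (fd ?F x w, conn_chart c x w))"
  proof (rule fibre_dimension_injective[OF S SB open_proj_dom[OF c \<kappa>] x _ linA surj \<D>(2)])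
    show "?F differentiable (at y)" if "y \<in> proj_dom c \<kappa>" for y
      by (rule proj_chart_differentiable[OF c \<kappa> that])
    show "(\<lambda>h. action_chart d c (h, x)) differentiable (at h)"
      if "d \<in> \<D>" "h \<in> {h. (h, x) \<in> action_dom d c}" for d h
      using that \<D>(1) partial_derivatives(1)[OF action_chart_differentiable[OF _ c]] differentiableI by blast
    fix y assume y: "y \<in> proj_dom c \<kappa>" "?F y = ?F x"
    let ?r = "chart_inv c y"
    have yc: "y \<in> snd c ` fst c" "orbit G \<phi> ?r \<in> fst \<kappa>" using y(1) by (auto simp: proj_dom_def)
    \<comment> \<open>Since \<kappa> is injective, equal coordinates mean equal orbits, so the fibre
      of ?F through x consists of translates of q, each seen in a chart from \<D>.\<close>
    have "snd \<kappa> (orbit G \<phi> ?r) = snd \<kappa> (orbit G \<phi> q)" using y(2) qc by (simp add: proj_chart_def)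
    then have "orbit G \<phi> ?r = orbit G \<phi> q"
      using is_chart_inj[OF smooth_manifold_chart[OF QG \<kappa>]] yc(2) \<pi>q by (meson inj_onD)
    then have "?r \<in> orbit G \<phi> q"
      using orbit_refl[OF chart_point[OF c chart_inv_in[OF yc(1)]]] by simp
    then obtain g where g: "g \<in> carrier G" "?r = \<phi> g q" by (auto simp: orbit_def)
    then obtain d where d: "d \<in> \<D>" "g \<in> fst d" using \<D>(3) by blast
    have gd: "chart_inv d (snd d g) = g"
      using chart_inv_snd[OF smooth_manifold_chart[OF GM]] d \<D>(1) by blast
    have "(snd d g, x) \<in> action_dom d c"
      using d g gd qc xc chart_inv_in[OF yc(1)] by (simp add: action_dom_def)
    moreover have "y = action_chart d c (snd d g, x)"
      using gd qc g snd_chart_inv[OF yc(1)] by (simp add: action_chart_def)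
    ultimately show "\<exists>d\<in>\<D>. \<exists>h\<in>{h. (h, x) \<in> action_dom d c}. y = action_chart d c (h, x)"
      using d(1) by blast
  qed
  then show "bij (\<lambda>w. (fd ?F x w, conn_chart c x w))" using surj by (simp add: bij_def)
qed

definition basic_lift :: "('q set, 'b) chart \<Rightarrow> 'b \<Rightarrow> 'q \<Rightarrow> 'e" where
  "basic_lift \<kappa> i = horizontal_lift G Q \<phi> QG \<A> (\<lambda>y. tangent_vector QG \<kappa> y i)"

text \<open>Bijectivity in \<open>frame_bij\<close> gives the definite description in
  \<open>horizontal_lift\<close> exactly one solution, which therefore has the defining
  properties.\<close>

lemma basic_lift:
  assumes c: "c \<in> atlas Q" "q \<in> fst c" and \<kappa>: "\<kappa> \<in> atlas QG" "orbit G \<phi> q \<in> fst \<kappa>"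
  shows "fd (proj_chart c \<kappa>) (snd c q) (components Q c q (basic_lift \<kappa> i q)) = i"
    and "\<A> (q, basic_lift \<kappa> i q) = 0"
proof -
  let ?T = "\<lambda>w. (fd (proj_chart c \<kappa>) (snd c q) w, conn_chart c (snd c q) w)"
  have bij: "bij ?T" by (rule frame_bij[OF c(1) \<kappa>(1) proj_dom_point[OF c(1) \<kappa>(1) c(2) \<kappa>(2)]])
  have iff: "tangent_map Q QG (orbit G \<phi>) q u = tangent_vector QG \<kappa> (orbit G \<phi> q) i \<and> \<A> (q, u) = 0
    \<longleftrightarrow> ?T (components Q c q u) = (i, 0)" for u
    using components_tangent_projection[OF c \<kappa>, of u] components_eq_conn_chart[OF c, of u]
      components_tangent_vector[OF QG \<kappa>] tangent_vector_components[OF QG \<kappa>] by (metis prod.inject)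
  obtain w where w: "?T w = (i, 0)" using surjD[OF bij_is_surj[OF bij], of "(i, 0)"] by force
  have "\<exists>!u. ?T (components Q c q u) = (i, 0)"
  proof (rule ex1I[of _ "tangent_vector Q c q w"])
    show "?T (components Q c q (tangent_vector Q c q w)) = (i, 0)"
      using w components_tangent_vector[OF Q c] by simp
    fix u assume "?T (components Q c q u) = (i, 0)"
    then have "?T (components Q c q u) = ?T w" using w by simp
    then have "components Q c q u = w" by (rule injD[OF bij_is_inj[OF bij]])
    then show "u = tangent_vector Q c q w" using tangent_vector_components[OF Q c, of u] by simp
  qed
  then have "?T (components Q c q (basic_lift \<kappa> i q)) = (i, 0)"
    unfolding basic_lift_def horizontal_lift_def iff by (rule theI')
  then show "fd (proj_chart c \<kappa>) (snd c q) (components Q c q (basic_lift \<kappa> i q)) = i"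
    "\<A> (q, basic_lift \<kappa> i q) = 0" using components_eq_conn_chart[OF c] by auto
qed

text \<open>In a chart the lift solves a linear system with constant right-hand side (i, 0) and
  coefficients differentiable in the point, so \<open>differentiable_solution\<close>
  applies.\<close>

lemma vf_in_basic_lift:
  assumes c: "c \<in> atlas Q" and \<kappa>: "\<kappa> \<in> atlas QG" and x: "x \<in> proj_dom c \<kappa>"
  shows "fd (proj_chart c \<kappa>) x (vf_in Q c (basic_lift \<kappa> i) x) = i"
    and "conn_chart c x (vf_in Q c (basic_lift \<kappa> i) x) = 0"
    and "vf_in Q c (basic_lift \<kappa> i) differentiable (at x)"
proof -
  have sol: "fd (proj_chart c \<kappa>) x (vf_in Q c (basic_lift \<kappa> i) x) = i"
    "conn_chart c x (vf_in Q c (basic_lift \<kappa> i) x) = 0" if "x \<in> proj_dom c \<kappa>" for x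
  proof -
    have x: "x \<in> snd c ` fst c" "orbit G \<phi> (chart_inv c x) \<in> fst \<kappa>" using that by (auto simp: proj_dom_def)
    note b = basic_lift[OF c chart_inv_in[OF x(1)] \<kappa> x(2), of i]
    show "fd (proj_chart c \<kappa>) x (vf_in Q c (basic_lift \<kappa> i) x) = i"
      using b(1) snd_chart_inv[OF x(1)] by (simp add: vf_in_def)
    show "conn_chart c x (vf_in Q c (basic_lift \<kappa> i) x) = 0"
      using b(2) snd_chart_inv[OF x(1)] components_eq_conn_chart[OF c chart_inv_in[OF x(1)]] by (simp add: vf_in_def)
  qed
  from sol x show "fd (proj_chart c \<kappa>) x (vf_in Q c (basic_lift \<kappa> i) x) = i"
    "conn_chart c x (vf_in Q c (basic_lift \<kappa> i) x) = 0" by auto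
  obtain S :: "'e set" where S: "is_basis S" using Q by (auto simp: smooth_manifold_def)
  have xc: "y \<in> snd c ` fst c" if "y \<in> proj_dom c \<kappa>" for y using that by (simp add: proj_dom_def)
  show "vf_in Q c (basic_lift \<kappa> i) differentiable (at x)"
  proof (rule differentiable_solution[where T = "\<lambda>y w. (fd (proj_chart c \<kappa>) y w, conn_chart c y w)",
        OF S open_proj_dom[OF c \<kappa>] x])
    show "linear (\<lambda>w. (fd (proj_chart c \<kappa>) y w, conn_chart c y w))" if "y \<in> proj_dom c \<kappa>" for y
    proof -
      have "linear (fd (proj_chart c \<kappa>) y)" "linear (conn_chart c y)"
        using linear_frechet_derivative[OF proj_chart_differentiable[OF c \<kappa> that]]
          conn_chart_linear[OF c xc[OF that]] by auto
      then show ?thesis by (intro linearI) (simp_all add: linear_add linear_scale)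
    qed
    show "bij (\<lambda>w. (fd (proj_chart c \<kappa>) x w, conn_chart c x w))" by (rule frame_bij[OF c \<kappa> x])
    show "(fd (proj_chart c \<kappa>) y (vf_in Q c (basic_lift \<kappa> i) y),
        conn_chart c y (vf_in Q c (basic_lift \<kappa> i) y)) = (i, 0)" if "y \<in> proj_dom c \<kappa>" for y
      using sol[OF that] by simp
    show "(\<lambda>y. (fd (proj_chart c \<kappa>) y u, conn_chart c y u)) differentiable (at x)" for u
      using smooth_on_differentiable[OF smooth_on_fd[OF smooth_proj_chart[OF c \<kappa>]] x, of u]
        conn_chart_differentiable[OF c xc[OF x], of u]
      by (auto simp: differentiable_def intro: has_derivative_Pair)
  qed
qed

end

section \<open>The frame and the Routhian\<close>

lemma representation_basis_sum:
  assumes B: "is_basis B" and b: "b \<in> B"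
  shows "representation B (\<Sum>b\<in>B. k b *\<^sub>R b) b = k b"
proof -
  have ind: "independent B" "finite B" "span B = UNIV" using B by (auto simp: is_basis_def)
  let ?u = "\<Sum>b\<in>B. k b *\<^sub>R b"
  have "(\<Sum>b\<in>B. (representation B ?u b - k b) *\<^sub>R b) = 0"
    using ind by (simp add: scaleR_left_diff_distrib sum_subtractf real_vector.sum_representation_eq)
  then show ?thesis using independentD[OF ind(1,2) order_refl _ b, of "\<lambda>b. representation B ?u b - k b"] by simp
qed

lemma sum_representation_basis:
  assumes "is_basis B" shows "(\<Sum>b\<in>B. representation B u b *\<^sub>R b) = u"
  using assms by (simp add: is_basis_def real_vector.sum_representation_eq)

lemma representation_outside: "b \<notin> B \<Longrightarrow> representation B u b = 0"
  using real_vector.representation_ne_zero by blast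

lemma linear_representation:
  assumes "is_basis B" shows "linear (\<lambda>u. representation B u b)"
  using assms unfolding is_basis_def
  by (intro linearI) (simp_all add: real_vector.representation_add real_vector.representation_scale)

lemma linear_basis_expansion:
  assumes B: "is_basis B" and f: "linear f"
  shows "f u = (\<Sum>b\<in>B. representation B u b *\<^sub>R f b)"
  using arg_cong[OF sum_representation_basis[OF B, of u], of f]
  by (simp add: linear_sum[OF f] linear_scale[OF f])

lemma coefficients_eqI:
  assumes k: "\<And>\<alpha>. \<alpha> \<notin> J \<Longrightarrow> k \<alpha> = 0" "u = (\<Sum>\<alpha>\<in>J. k \<alpha> *\<^sub>R w \<alpha>)"
    and unique: "\<And>k' \<alpha>. u = (\<Sum>\<alpha>\<in>J. k' \<alpha> *\<^sub>R w \<alpha>) \<Longrightarrow> \<alpha> \<in> J \<Longrightarrow> k' \<alpha> = k \<alpha>"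
  shows "coefficients J w u = k"
  unfolding coefficients_def
proof (rule the_equality)
  show "(\<forall>\<alpha>. \<alpha> \<notin> J \<longrightarrow> k \<alpha> = 0) \<and> u = (\<Sum>\<alpha>\<in>J. k \<alpha> *\<^sub>R w \<alpha>)" using k by simp
  fix k' assume k': "(\<forall>\<alpha>. \<alpha> \<notin> J \<longrightarrow> k' \<alpha> = 0) \<and> u = (\<Sum>\<alpha>\<in>J. k' \<alpha> *\<^sub>R w \<alpha>)"
  show "k' = k"
  proof
    fix \<alpha> show "k' \<alpha> = k \<alpha>"
      using k' k(1)[of \<alpha>] unique[of k' \<alpha>] by (cases "\<alpha> \<in> J") auto
  qed
qed

section \<open>Brackets and complete lifts in coordinates\<close>

text \<open>\<open>smooth_on\<close> controls \<open>\<lambda>y. fd F y b\<close> for a fixed vector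
  b. Expanding the moving argument X y in a basis reduces the claim to finitely many fixed vectors
  and the product rule.\<close>

lemma has_derivative_fd_apply:
  fixes F :: "'a::real_normed_vector \<Rightarrow> 'b::real_normed_vector"
  assumes S: "is_basis (S::'a set)" and U: "open U" "x \<in> U" and F: "smooth_on F U"
    and X: "X differentiable (at x)"
  shows "((\<lambda>y. fd F y (X y)) has_derivative (\<lambda>h. fd (\<lambda>y. fd F y (X x)) x h + fd F x (fd X x h))) (at x)"
proof -
  let ?r = "representation S"
  have lin: "linear (fd F y)" if "y \<in> U" for y
    using linear_frechet_derivative[OF smooth_on_differentiable[OF F that]] .
  have exp: "fd F y u = (\<Sum>b\<in>S. ?r u b *\<^sub>R fd F y b)" if "y \<in> U" for y u
    by (rule linear_basis_expansion[OF S lin[OF that]])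
  have dFb: "((\<lambda>y. fd F y b) has_derivative fd (\<lambda>y. fd F y b) x) (at x)" for b
    by (rule has_derivative_fd[OF smooth_on_differentiable[OF smooth_on_fd[OF F] U(2)]])
  have drX: "((\<lambda>y. ?r (X y) b) has_derivative (\<lambda>h. ?r (fd X x h) b)) (at x)" for b
    using bounded_linear.has_derivative[OF bounded_linear_finite_dim[OF S linear_representation[OF S, of b]]
        has_derivative_fd[OF X]] .
  have D: "((\<lambda>y. \<Sum>b\<in>S. ?r (X y) b *\<^sub>R fd F y b) has_derivative
      (\<lambda>h. \<Sum>b\<in>S. ?r (X x) b *\<^sub>R fd (\<lambda>y. fd F y b) x h + ?r (fd X x h) b *\<^sub>R fd F x b)) (at x)"
    by (intro has_derivative_sum has_derivative_scaleR drX dFb)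
  have "((\<lambda>y. \<Sum>b\<in>S. ?r (X x) b *\<^sub>R fd F y b) has_derivative
      (\<lambda>h. \<Sum>b\<in>S. ?r (X x) b *\<^sub>R fd (\<lambda>y. fd F y b) x h)) (at x)"
    by (intro has_derivative_sum has_derivative_scaleR_right dFb)
  then have "((\<lambda>y. fd F y (X x)) has_derivative
      (\<lambda>h. \<Sum>b\<in>S. ?r (X x) b *\<^sub>R fd (\<lambda>y. fd F y b) x h)) (at x)"
    by (rule has_derivative_transform_within_open[OF _ U]) (simp add: exp)
  then have 1: "fd (\<lambda>y. fd F y (X x)) x h = (\<Sum>b\<in>S. ?r (X x) b *\<^sub>R fd (\<lambda>y. fd F y b) x h)" for h
    by (simp add: fd_eqI)
  have "((\<lambda>y. fd F y (X y)) has_derivative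
      (\<lambda>h. \<Sum>b\<in>S. ?r (X x) b *\<^sub>R fd (\<lambda>y. fd F y b) x h + ?r (fd X x h) b *\<^sub>R fd F x b)) (at x)"
    by (rule has_derivative_transform_within_open[OF D U]) (simp add: exp)
  then show ?thesis
    by (rule has_derivative_eq_rhs) (simp add: fun_eq_iff 1 exp[OF U(2), symmetric] sum.distrib)
qed

text \<open>X and Y are F-related to constant fields, whose bracket is 0. Concretely, differentiate
  DF(X) = i along Y and DF(Y) = j along X and subtract: the second derivatives of F cancel by
  symmetry.\<close>

lemma related_bracket_kernel:
  fixes F :: "'a::real_normed_vector \<Rightarrow> 'b::real_normed_vector"
  assumes S: "is_basis (S::'a set)" and U: "open U" "x \<in> U" and F: "smooth_on F U"
    and X: "X differentiable (at x)" "\<And>y. y \<in> U \<Longrightarrow> fd F y (X y) = i"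
    and Y: "Y differentiable (at x)" "\<And>y. y \<in> U \<Longrightarrow> fd F y (Y y) = j"
  shows "fd F x (fd Y x (X x) - fd X x (Y x)) = 0"
proof -
  have const: "fd (\<lambda>y. fd F y (Z x)) x h + fd F x (fd Z x h) = 0"
    if "Z differentiable (at x)" "\<And>y. y \<in> U \<Longrightarrow> fd F y (Z y) = k" for Z k h
  proof -
    have "fd (\<lambda>y. fd F y (Z y)) x = fd (\<lambda>y. k) x" by (rule fd_cong_open[OF U that(2)])
    then show ?thesis
      using fd_eqI[OF has_derivative_fd_apply[OF S U F that(1)]] by (simp add: fun_eq_iff)
  qed
  have "fd (\<lambda>y. fd F y (X x)) x (Y x) = fd (\<lambda>y. fd F y (Y x)) x (X x)"
    by (rule fd_symmetric[OF U smooth_on_differentiable[OF F]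
        smooth_on_differentiable[OF smooth_on_fd[OF F] U(2)] smooth_on_differentiable[OF smooth_on_fd[OF F] U(2)]])
  moreover have "linear (fd F x)"
    using linear_frechet_derivative[OF smooth_on_differentiable[OF F U(2)]] .
  ultimately show ?thesis
    using const[OF X, of "Y x"] const[OF Y, of "X x"] by (simp add: linear_diff) (metis add_left_cancel)
qed

text \<open>Cartan's formula: for \<open>u = X(x)\<close> and \<open>w = DX(x) Y(x)\<close> the last argument is the bracket \<open>[X, Y](x)\<close>.\<close>

lemma complete_lift_fibre_linear:
  fixes A :: "'a::real_normed_vector \<times> 'a \<Rightarrow> 'b::real_normed_vector"
  assumes A: "A differentiable (at (x, Y x))" and lin: "bounded_linear (\<lambda>w. A (x, w))"
    and Y: "Y differentiable (at x)"
  shows "fd A (x, Y x) (u, w) = fd (\<lambda>y. A (y, Y y)) x u - A (x, fd Y x u - w)"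
proof -
  have "((\<lambda>y. (y, Y y)) has_derivative (\<lambda>h. (h, fd Y x h))) (at x)"
    using has_derivative_fd[OF Y] by (intro has_derivative_Pair has_derivative_ident)
  from fd_eqI[OF has_derivative_compose[OF this has_derivative_fd[OF A]]]
  have 1: "fd (\<lambda>y. A (y, Y y)) x u = fd A (x, Y x) (u, fd Y x u)" by simp
  have 2: "A (x, z) = fd A (x, Y x) (0, z)" for z
    using has_derivative_unique[OF partial_derivatives(2)[OF A] bounded_linear_imp_has_derivative[OF lin]]
    by (simp add: fun_eq_iff)
  have "fd A (x, Y x) (u, fd Y x u) - fd A (x, Y x) (0, fd Y x u - w) = fd A (x, Y x) (u, w)"
    using linear_diff[OF linear_frechet_derivative[OF A], of "(u, fd Y x u)" "(0, fd Y x u - w)"] by simp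
  then show ?thesis unfolding 1 2 by simp
qed

section \<open>The adapted frame at a point\<close>

text \<open>Everything is evaluated at one point q in its reference chart; neighbouring points are
  reached by instantiating the locale again, each with its own reference chart.\<close>

locale principal_bundle_frame = principal_bundle G GM Q \<phi> QG \<A>
  for G :: "('g, 'm) monoid_scheme"
    and GM :: "('g, 'l::real_normed_vector) manifold"
    and Q :: "('q, 'e::real_normed_vector) manifold"
    and \<phi> :: "'g \<Rightarrow> 'q \<Rightarrow> 'q"
    and QG :: "('q set, 'b::real_normed_vector) manifold"
    and \<A> :: "'q \<times> 'e \<Rightarrow> 'l" +
  fixes BB :: "'b set" and EE :: "'l set" and \<kappa> :: "('q set, 'b) chart" and q :: 'q
  assumes BB: "is_basis BB" and EE: "is_basis EE"
    and \<kappa>: "\<kappa> \<in> atlas QG" and q: "q \<in> topspace (mtop Q)" and \<pi>q: "orbit G \<phi> q \<in> fst \<kappa>"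
begin

abbreviation "frame \<equiv> adapted_frame G GM Q \<phi> QG \<A> \<kappa>"
abbreviation "c \<equiv> chart_at Q q"
abbreviation "x \<equiv> snd c q"
abbreviation "F \<equiv> proj_chart c \<kappa>"
abbreviation "U \<equiv> proj_dom c \<kappa>"
abbreviation "X \<equiv> \<lambda>i. vf_in Q c (basic_lift \<kappa> i)"
abbreviation "E \<equiv> \<lambda>a. vf_in Q c (fundamental_field G GM Q \<phi> a)"
abbreviation "Ac \<equiv> in_natural_coords Q c \<A>"

lemma frame_Inl: "frame (Inl i) = basic_lift \<kappa> i"
  and frame_Inr: "frame (Inr a) = fundamental_field G GM Q \<phi> a"
  by (simp_all add: adapted_frame_def basic_lift_def)

lemma c: "c \<in> atlas Q" "q \<in> fst c" using chart_at_atlas[OF Q q] .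

lemma xU: "x \<in> U" using proj_dom_point[OF c(1) \<kappa> c(2) \<pi>q] .

lemma U_chart: "y \<in> U \<Longrightarrow> y \<in> snd c ` fst c" by (simp add: proj_dom_def)

lemma openU: "open U" using open_proj_dom[OF c(1) \<kappa>] .

lemma components_c [simp]: "components Q c q v = v"
  using components_chart_at[OF Q q] .

lemma vf_in_x: "vf_in Q c V x = V q"
  using chart_inv_snd[OF smooth_manifold_chart[OF Q c(1)] c(2)] by (simp add: vf_in_def)

lemma Ac_conn_chart: "Ac (y, w) = conn_chart c y w"
  by (simp add: conn_chart_def)

lemma Ac_x: "Ac (x, v) = \<A> (q, v)"
  using components_eq_conn_chart[OF c, of v] by (simp add: Ac_conn_chart)

lemma finite_dim_Q: obtains S :: "'e set" where "is_basis S"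
  using Q by (auto simp: smooth_manifold_def)

lemma linF: "linear (fd F x)"
  using linear_frechet_derivative[OF proj_chart_differentiable[OF c(1) \<kappa> xU]] .

lemma linA: "linear (\<lambda>v. \<A> (q, v))" using connection_linear[OF q] .

lemma XF: "y \<in> U \<Longrightarrow> fd F y (X i y) = i" and XA: "y \<in> U \<Longrightarrow> Ac (y, X i y) = 0"
  and Xd: "X i differentiable (at x)"
  using vf_in_basic_lift[OF c(1) \<kappa>] xU by (simp_all add: Ac_conn_chart)

lemma EF: "y \<in> U \<Longrightarrow> fd F y (E a y) = 0" and EA: "y \<in> U \<Longrightarrow> Ac (y, E a y) = a"
  using frame_bij(2,3)[OF c(1) \<kappa>] by (simp_all add: Ac_conn_chart)

lemma Ed: "E a differentiable (at x)"
proof -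
  have "(\<lambda>z. fd (action_chart unit_chart c) z (a, 0)) differentiable (at (unit_coord, x))"
    using smooth_on_differentiable[OF smooth_on_fd[OF smooth_action_chart[OF unit_chart(1) c(1)]]]
      unit_action_dom[OF c(1)] c(2) by simp
  from differentiableI[OF partial_derivatives(2)[OF this]] show ?thesis
  proof (rule differentiable_cong_open)
    show "open (snd c ` fst c)" using smooth_manifold_chart[OF Q c(1)] by (simp add: is_chart_def)
  qed (use c in \<open>simp_all add: vf_in_fundamental_field\<close>)
qed

lemma frame_injective:
  assumes "fd F x u = fd F x w" "\<A> (q, u) = \<A> (q, w)" shows "u = w"
  using injD[OF bij_is_inj[OF frame_bij(1)[OF c(1) \<kappa> xU]], of u w] assms
  by (simp add: Ac_conn_chart[symmetric] Ac_x)

lemma frame_projection: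
  "fd F x (basic_lift \<kappa> i q) = i" "\<A> (q, basic_lift \<kappa> i q) = 0"
  "fd F x (fundamental_field G GM Q \<phi> a q) = 0" "\<A> (q, fundamental_field G GM Q \<phi> a q) = a"
  using XF[OF xU, of i] XA[OF xU, of i] EF[OF xU, of a] EA[OF xU, of a] by (simp_all add: vf_in_x Ac_x)

text \<open>The pair (fd F x, A) sends X_i to (i, 0) and the fundamental field of a to (0, a), hence
  acts as a coframe: its injectivity gives the expansion, and applying it to an expansion gives
  uniqueness.\<close>

lemma coefficients_frame:
  "coefficients (BB <+> EE) (\<lambda>\<beta>. frame \<beta> q) v
    = case_sum (representation BB (fd F x v)) (representation EE (\<A> (q, v)))" (is "_ = ?k")
  and frame_expansion: "v = (\<Sum>\<alpha>\<in>BB <+> EE.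
    case_sum (representation BB (fd F x v)) (representation EE (\<A> (q, v))) \<alpha> *\<^sub>R frame \<alpha> q)"
proof -
  have fin: "finite BB" "finite EE" using BB EE by (auto simp: is_basis_def)
  have T: "fd F x (\<Sum>\<alpha>\<in>BB <+> EE. k \<alpha> *\<^sub>R frame \<alpha> q) = (\<Sum>i\<in>BB. k (Inl i) *\<^sub>R i)"
    "\<A> (q, \<Sum>\<alpha>\<in>BB <+> EE. k \<alpha> *\<^sub>R frame \<alpha> q) = (\<Sum>a\<in>EE. k (Inr a) *\<^sub>R a)" for k
    using fin
    by (simp_all add: sum.Plus linear_add[OF linF] linear_sum[OF linF] linear_scale[OF linF]
        linear_add[OF linA] linear_sum[OF linA] linear_scale[OF linA] frame_Inl frame_Inr frame_projection)
  show exp: "v = (\<Sum>\<alpha>\<in>BB <+> EE. ?k \<alpha> *\<^sub>R frame \<alpha> q)"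
    by (rule frame_injective) (simp_all only: T sum.case sum_representation_basis[OF BB] sum_representation_basis[OF EE])
  show "coefficients (BB <+> EE) (\<lambda>\<beta>. frame \<beta> q) v = ?k"
  proof (rule coefficients_eqI[OF _ exp])
    show "?k \<alpha> = 0" if "\<alpha> \<notin> BB <+> EE" for \<alpha>
      using that by (cases \<alpha>) (auto intro: representation_outside)
    fix k' \<alpha> assume v: "v = (\<Sum>\<alpha>\<in>BB <+> EE. k' \<alpha> *\<^sub>R frame \<alpha> q)" and \<alpha>: "\<alpha> \<in> BB <+> EE"
    show "k' \<alpha> = ?k \<alpha>"
      using T[of k', folded v] \<alpha> representation_basis_sum[OF BB, of _ "\<lambda>i. k' (Inl i)"]
        representation_basis_sum[OF EE, of _ "\<lambda>a. k' (Inr a)"] by auto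
  qed
qed

lemma quasi_velocity_Inl: "quasi_velocity (BB <+> EE) frame (Inl i) (q, v) = representation BB (fd F x v) i"
  and quasi_velocity_Inr: "quasi_velocity (BB <+> EE) frame (Inr a) (q, v) = representation EE (\<A> (q, v)) a"
  by (simp_all add: quasi_velocity_def coefficients_frame)

lemma Ac_differentiable: "Ac differentiable (at (x, v))"
  using connection_smooth c
  by (intro smooth_on_differentiable[of _ "(snd c ` fst c) \<times> UNIV"]) (auto simp: smooth_on_tangent_bundle_def)

lemma Ac_bounded_linear: "bounded_linear (\<lambda>w. Ac (x, w))"
  using finite_dim_Q bounded_linear_finite_dim linA by (metis (no_types, lifting) Ac_x ext)

text \<open>The bracket of X_i with a fundamental field is horizontal. Along the lifted action of
  X_i the form stays 0, so \<open>invariant_complete_lift\<close> applies at this one vector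
  although the form is only equivariant; Cartan's formula turns the result into a bracket.\<close>

lemma connection_bracket_fundamental:
  "\<A> (q, fd (E a) x (X i x) - fd (X i) x (E a x)) = 0"
proof -
  have trans0: "\<A> (\<phi> (chart_inv unit_chart h) q, tangent_map Q Q (\<phi> (chart_inv unit_chart h)) q (X i x)) = \<A> (q, X i x)"
    if h: "(h, x) \<in> action_dom unit_chart c" for h
  proof -
    let ?g = "chart_inv unit_chart h"
    have g: "?g \<in> carrier G" "\<phi> ?g q \<in> fst c"
      using h chart_inv_carrier[OF unit_chart(1)] chart_inv_snd[OF smooth_manifold_chart[OF Q c(1)] c(2)]
      by (auto simp: action_dom_def)
    have "components Q c (\<phi> ?g q) (tangent_map Q Q (\<phi> ?g) q 0) = 0"
      using components_tangent_translation[OF q refl unit_chart(1) h, of 0]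
        linear_0[OF linear_frechet_derivative[OF action_chart_differentiable[OF unit_chart(1) c(1) h]]]
      by (simp add: zero_prod_def)
    then have "tangent_map Q Q (\<phi> ?g) q 0 = 0"
      using tangent_vector_components[OF Q c(1) g(2), of "tangent_map Q Q (\<phi> ?g) q 0"]
        linear_0[OF linear_tangent_vector[OF Q c(1) g(2)]] by simp
    \<comment> \<open>Obtained from equivariance at the zero vector of Q, so that linearity of
      \<open>Ad\<close> need not be established.\<close>
    then have "Ad G GM ?g 0 = 0"
      using connection_equivariant[OF q g(1), of 0] linear_0[OF linA]
        linear_0[OF connection_linear[OF chart_point[OF c(1) g(2)]]] by simp
    then show ?thesis
      using connection_equivariant[OF q g(1), of "X i x"] XA[OF xU, of i] by (simp add: Ac_x)
  qed
  have "fd Ac (x, X i x) (E a x, fd (E a) x (X i x)) = 0"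
    by (rule invariant_complete_lift[OF connection_smooth q trans0])
  moreover have "fd (\<lambda>y. Ac (y, X i y)) x = fd (\<lambda>y. 0) x"
    by (rule fd_cong_open[OF openU xU XA])
  ultimately have "\<A> (q, fd (X i) x (E a x) - fd (E a) x (X i x)) = 0"
    using complete_lift_fibre_linear[OF Ac_differentiable Ac_bounded_linear Xd, of i "E a x" "fd (E a) x (X i x)"]
    by (simp add: Ac_x)
  then show ?thesis
    using linear_neg[OF linA, of "fd (X i) x (E a x) - fd (E a) x (X i x)"] by simp
qed

lemma lie_bracket_basic: "lie_bracket Q (basic_lift \<kappa> i) (basic_lift \<kappa> j) q = fd (X j) x (X i x) - fd (X i) x (X j x)"
  by (simp add: lie_bracket_def Let_def)

text \<open>[X_i, X_j] is vertical by \<open>related_bracket_kernel\<close>, so the fundamental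
  fields suffice to expand it and the connection form reads off the coefficients.\<close>

lemma curvature_coeff_frame:
  "curvature_coeff Q EE frame a i j q = representation EE (\<A> (q, lie_bracket Q (basic_lift \<kappa> i) (basic_lift \<kappa> j) q)) a"
proof -
  let ?u = "lie_bracket Q (basic_lift \<kappa> i) (basic_lift \<kappa> j) q"
  let ?k = "representation EE (\<A> (q, ?u))"
  obtain S :: "'e set" where S: "is_basis S" by (rule finite_dim_Q)
  have F0: "fd F x ?u = 0"
    unfolding lie_bracket_basic
    by (rule related_bracket_kernel[OF S openU xU smooth_proj_chart[OF c(1) \<kappa>] Xd XF Xd XF])
  have T: "fd F x (\<Sum>a\<in>EE. k a *\<^sub>R frame (Inr a) q) = 0"
    "\<A> (q, \<Sum>a\<in>EE. k a *\<^sub>R frame (Inr a) q) = (\<Sum>a\<in>EE. k a *\<^sub>R a)" for k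
    by (simp_all add: linear_sum[OF linF] linear_scale[OF linF]
        linear_sum[OF linA] linear_scale[OF linA] frame_Inr frame_projection)
  have "coefficients EE (\<lambda>b. frame (Inr b) q) ?u = ?k"
  proof (rule coefficients_eqI)
    show "?u = (\<Sum>a\<in>EE. ?k a *\<^sub>R frame (Inr a) q)"
      by (rule frame_injective) (simp_all only: T F0 sum_representation_basis[OF EE])
    fix k' b assume u: "?u = (\<Sum>a\<in>EE. k' a *\<^sub>R frame (Inr a) q)" and b: "b \<in> EE"
    show "k' b = ?k b" using T(2)[of k', folded u] representation_basis_sum[OF EE b, of k'] by simp
  qed (rule representation_outside)
  then show ?thesis by (simp add: curvature_coeff_def frame_Inl)
qed

lemma connection_complete_lift:
  "fd Ac (x, v) (X i x, fd (X i) x v)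
    = - (\<Sum>j\<in>BB. quasi_velocity (BB <+> EE) frame (Inl j) (q, v) *\<^sub>R
          \<A> (q, lie_bracket Q (basic_lift \<kappa> i) (basic_lift \<kappa> j) q))"
proof -
  let ?m = "representation BB (fd F x v)" and ?n = "representation EE (\<A> (q, v))"
  have fin: "finite BB" "finite EE" using BB EE by (auto simp: is_basis_def)
  define Y where "Y = (\<lambda>y. (\<Sum>j\<in>BB. ?m j *\<^sub>R X j y) + (\<Sum>a\<in>EE. ?n a *\<^sub>R E a y))"
  have Yx: "Y x = v"
    using frame_expansion[of v] fin by (simp add: Y_def vf_in_x sum.Plus frame_Inl frame_Inr)
  have Y': "(Y has_derivative (\<lambda>h. (\<Sum>j\<in>BB. ?m j *\<^sub>R fd (X j) x h) + (\<Sum>a\<in>EE. ?n a *\<^sub>R fd (E a) x h))) (at x)"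
    unfolding Y_def
    by (intro has_derivative_add has_derivative_sum has_derivative_scaleR_right has_derivative_fd Xd Ed)
  have AY: "Ac (y, Y y) = (\<Sum>a\<in>EE. ?n a *\<^sub>R a)" if "y \<in> U" for y
  proof -
    have l: "linear (\<lambda>w. Ac (y, w))" using conn_chart_linear[OF c(1) U_chart[OF that]] by (simp add: Ac_conn_chart)
    show ?thesis
      unfolding Y_def
      by (simp add: linear_add[OF l] linear_sum[OF l] linear_scale[OF l] XA[OF that] EA[OF that])
  qed
  have const: "fd (\<lambda>y. Ac (y, Y y)) x (X i x) = 0"
    using fd_cong_open[OF openU xU AY] by simp
  have linX: "linear (fd (X i) x)" using linear_frechet_derivative[OF Xd] .
  have "fd Ac (x, Y x) (X i x, fd (X i) x (Y x)) = - \<A> (q, fd Y x (X i x) - fd (X i) x (Y x))"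
    using complete_lift_fibre_linear[OF Ac_differentiable Ac_bounded_linear differentiableI[OF Y'], of "X i x"] const
    by (simp add: Ac_x)
  also have "fd Y x (X i x) - fd (X i) x (Y x) =
    (\<Sum>j\<in>BB. ?m j *\<^sub>R lie_bracket Q (basic_lift \<kappa> i) (basic_lift \<kappa> j) q)
    + (\<Sum>a\<in>EE. ?n a *\<^sub>R (fd (E a) x (X i x) - fd (X i) x (E a x)))"
    unfolding fd_eqI[OF Y'] lie_bracket_basic
    by (simp add: Y_def linear_add[OF linX] linear_sum[OF linX] linear_scale[OF linX]
        scaleR_diff_right sum_subtractf)
  also have "\<A> (q, \<dots>) = (\<Sum>j\<in>BB. ?m j *\<^sub>R \<A> (q, lie_bracket Q (basic_lift \<kappa> i) (basic_lift \<kappa> j) q))"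
    by (simp add: linear_add[OF linA] linear_sum[OF linA] linear_scale[OF linA] connection_bracket_fundamental)
  finally show ?thesis by (simp add: Yx quasi_velocity_Inl)
qed

section \<open>Derivatives of the Routhian and of the base coordinates\<close>

lemma routhian_eq:
  assumes "linear \<mu>" shows "routhian BB EE frame L \<mu> (q, v) = L (q, v) - \<mu> (\<A> (q, v))"
  using linear_basis_expansion[OF EE assms, of "\<A> (q, v)"]
  by (simp add: routhian_def quasi_velocity_Inr mult.commute)

text \<open>A derivative needs \<open>routhian_eq\<close> on a whole neighbourhood, hence the locale
  at every point over U, always with the same \<kappa> so that the frame fields agree.\<close>

lemma fd_routhian:
  assumes L: "smooth_on_tangent_bundle Q L" and \<mu>: "linear \<mu>"
  shows "fd (in_natural_coords Q c (routhian BB EE frame L \<mu>)) (x, v) d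
    = fd (in_natural_coords Q c L) (x, v) d - \<mu> (fd Ac (x, v) d)"
proof -
  let ?L = "in_natural_coords Q c L" and ?R = "in_natural_coords Q c (routhian BB EE frame L \<mu>)"
  have eq: "?R z = ?L z - \<mu> (Ac z)" if z': "z \<in> U \<times> UNIV" for z
  proof -
    obtain y w where z: "z = (y, w)" "y \<in> U" using z' by auto
    have r: "chart_inv c y \<in> fst c" "orbit G \<phi> (chart_inv c y) \<in> fst \<kappa>"
      using chart_inv_in[OF U_chart[OF z(2)]] z(2) by (auto simp: proj_dom_def)
    have "principal_bundle_frame G GM Q \<phi> QG \<A> BB EE \<kappa> (chart_inv c y)"
      using principal_bundle_axioms BB EE \<kappa> r chart_point[OF c(1) r(1)]
      by (simp add: principal_bundle_frame_def principal_bundle_frame_axioms_def)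
    from principal_bundle_frame.routhian_eq[OF this \<mu>]
    show ?thesis by (simp add: z(1) in_natural_coords_def)
  qed
  have "?L differentiable (at (x, v))"
    using L c by (intro smooth_on_differentiable[of _ "(snd c ` fst c) \<times> UNIV"]) (auto simp: smooth_on_tangent_bundle_def)
  then have "((\<lambda>z. ?L z - \<mu> (Ac z)) has_derivative (\<lambda>d. fd ?L (x, v) d - \<mu> (fd Ac (x, v) d))) (at (x, v))"
    by (intro has_derivative_diff bounded_linear.has_derivative[OF bounded_linear_finite_dim[OF EE \<mu>]]
        has_derivative_fd Ac_differentiable)
  from fd_eqI[OF this] show ?thesis
    using fd_cong_open[OF open_Times[OF openU open_UNIV], of "(x, v)" ?R "\<lambda>z. ?L z - \<mu> (Ac z)"] eq xU by simp
qed

lemma vertical_lift_routhian: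
  assumes "smooth_on_tangent_bundle Q L" "linear \<mu>"
  shows "vertical_lift Q V (routhian BB EE frame L \<mu>) (q, v) = vertical_lift Q V L (q, v) - \<mu> (\<A> (q, V q))"
proof -
  have "fd Ac (x, v) (0, w) = Ac (x, w)" for w
    using has_derivative_unique[OF partial_derivatives(2)[OF Ac_differentiable] bounded_linear_imp_has_derivative[OF Ac_bounded_linear]]
    by (simp add: fun_eq_iff)
  then show ?thesis
    using fd_routhian[OF assms] by (simp add: vertical_lift_def Let_def vf_in_x Ac_x)
qed

text \<open>The curvature term exactly compensates the complete lift of the subtracted function
  \<mu>(A); the Routh equation for p_i thereby becomes the Euler-Lagrange equation.\<close>

lemma complete_lift_routhian:
  assumes "smooth_on_tangent_bundle Q L" and \<mu>: "linear \<mu>"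
  shows "complete_lift Q (frame (Inl i)) (routhian BB EE frame L \<mu>) (q, v)
    - (\<Sum>a\<in>EE. \<Sum>j\<in>BB. \<mu> a * curvature_coeff Q EE frame a i j q * quasi_velocity (BB <+> EE) frame (Inl j) (q, v))
    = complete_lift Q (frame (Inl i)) L (q, v)"
proof -
  let ?m = "\<lambda>j. quasi_velocity (BB <+> EE) frame (Inl j) (q, v)"
  let ?B = "\<lambda>j. \<A> (q, lie_bracket Q (basic_lift \<kappa> i) (basic_lift \<kappa> j) q)"
  have "\<mu> (fd Ac (x, v) (X i x, fd (X i) x v)) = - (\<Sum>j\<in>BB. ?m j * \<mu> (?B j))"
    unfolding connection_complete_lift by (simp add: linear_neg[OF \<mu>] linear_sum[OF \<mu>] linear_scale[OF \<mu>])
  also have "(\<Sum>j\<in>BB. ?m j * \<mu> (?B j)) = (\<Sum>j\<in>BB. \<Sum>a\<in>EE. \<mu> a * curvature_coeff Q EE frame a i j q * ?m j)"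
    by (subst linear_basis_expansion[OF EE \<mu>]) (simp add: curvature_coeff_frame sum_distrib_left mult_ac)
  also have "\<dots> = (\<Sum>a\<in>EE. \<Sum>j\<in>BB. \<mu> a * curvature_coeff Q EE frame a i j q * ?m j)"
    by (rule sum.swap)
  finally show ?thesis
    using fd_routhian[OF assms, of v "(X i x, fd (X i) x v)"] by (simp add: complete_lift_def Let_def frame_Inl)
qed

lemma has_derivative_base_coordinate:
  assumes \<gamma>: "differentiable_curve Q I \<gamma>" and t: "t \<in> I" "\<gamma> t = q"
  shows "((\<lambda>s. representation BB (snd \<kappa> (orbit G \<phi> (\<gamma> s))) i) has_real_derivative
    quasi_velocity (BB <+> EE) frame (Inl i) (q, velocity Q I \<gamma> t)) (at t within I)"
proof -
  let ?w = "velocity Q I \<gamma> t"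
  have "(snd c \<circ> \<gamma>) differentiable (at t within I)" using \<gamma> t c by (simp add: differentiable_curve_def)
  then have "((snd c \<circ> \<gamma>) has_derivative (\<lambda>k. k *\<^sub>R ?w)) (at t within I)"
    unfolding velocity_def using t(2) by (simp add: vector_derivative_works has_vector_derivative_def)
  moreover have "(F has_derivative fd F x) (at ((snd c \<circ> \<gamma>) t))"
    using has_derivative_fd[OF proj_chart_differentiable[OF c(1) \<kappa> xU]] t(2) by simp
  ultimately have "((\<lambda>s. F ((snd c \<circ> \<gamma>) s)) has_derivative (\<lambda>k. fd F x (k *\<^sub>R ?w))) (at t within I)"
    by (rule has_derivative_compose)
  from bounded_linear.has_derivative[OF bounded_linear_finite_dim[OF BB linear_representation[OF BB, of i]] this]
  have D: "((\<lambda>s. representation BB (F ((snd c \<circ> \<gamma>) s)) i) has_derivative (\<lambda>k. representation BB (fd F x ?w) i * k)) (at t within I)"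
    by (simp add: linear_scale[OF linF] linear_scale[OF linear_representation[OF BB]] mult.commute)
  \<comment> \<open>The chart c sees the curve only near t. By continuity the curve stays in its
    domain for nearby times in I, which suffices for a derivative within I.\<close>
  have "continuous_map (top_of_set I) (mtop Q) \<gamma>" using \<gamma> by (simp add: differentiable_curve_def)
  moreover have "openin (mtop Q) (fst c)" using smooth_manifold_chart[OF Q c(1)] by (simp add: is_chart_def)
  ultimately have "openin (top_of_set I) {s \<in> topspace (top_of_set I). \<gamma> s \<in> fst c}"
    by (rule openin_continuous_map_preimage)
  then obtain W where W: "open W" "{s \<in> I. \<gamma> s \<in> fst c} = I \<inter> W" by (auto simp: openin_open)
  have "t \<in> W" using W(2) t c(2) by auto
  have "((\<lambda>s. representation BB (snd \<kappa> (orbit G \<phi> (\<gamma> s))) i) has_derivative (\<lambda>k. representation BB (fd F x ?w) i * k)) (at t within I)"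
  proof (rule has_derivative_transform_eventually[OF D])
    show "\<forall>\<^sub>F s in at t within I. representation BB (F ((snd c \<circ> \<gamma>) s)) i = representation BB (snd \<kappa> (orbit G \<phi> (\<gamma> s))) i"
      unfolding eventually_at_topological
    proof (intro exI conjI ballI impI)
      fix s assume "s \<in> W" "s \<in> I"
      then have "\<gamma> s \<in> fst c" using W(2) by auto
      then show "representation BB (F ((snd c \<circ> \<gamma>) s)) i = representation BB (snd \<kappa> (orbit G \<phi> (\<gamma> s))) i"
        using chart_inv_snd[OF smooth_manifold_chart[OF Q c(1)]] by (simp add: proj_chart_def)
    qed (use W \<open>t \<in> W\<close> in auto)
    show "representation BB (F ((snd c \<circ> \<gamma>) t)) i = representation BB (snd \<kappa> (orbit G \<phi> (\<gamma> t))) i"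
      using chart_inv_snd[OF smooth_manifold_chart[OF Q c(1)] c(2)] t(2) by (simp add: proj_chart_def)
  qed (use t in auto)
  then show ?thesis by (simp add: has_field_derivative_def quasi_velocity_Inl)
qed

end

context principal_bundle
begin

lemma complete_lift_fundamental_field:
  assumes L: "smooth_on_tangent_bundle Q L" and inv: "invariant_lagrangian G Q \<phi> L" and q: "q \<in> topspace (mtop Q)"
  shows "complete_lift Q (fundamental_field G GM Q \<phi> a) L (q, v) = 0"
proof -
  have "L (\<phi> (chart_inv unit_chart h) q, tangent_map Q Q (\<phi> (chart_inv unit_chart h)) q v) = L (q, v)"
    if "(h, snd (chart_at Q q) q) \<in> action_dom unit_chart (chart_at Q q)" for h
  proof -
    have "chart_inv unit_chart h \<in> carrier G"
      using that chart_inv_carrier[OF unit_chart(1)] by (auto simp: action_dom_def)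
    then show ?thesis using inv q by (simp add: invariant_lagrangian_def)
  qed
  from invariant_complete_lift[OF L q this] show ?thesis
    by (simp add: complete_lift_def Let_def components_chart_at[OF Q q])
qed

text \<open>A partial derivative of the action in the reference chart. This makes the momentum at a
  fixed time a linear functional on the Lie algebra.\<close>

lemma linear_fundamental_field:
  assumes q: "q \<in> topspace (mtop Q)" shows "linear (\<lambda>a. fundamental_field G GM Q \<phi> a q)"
proof -
  let ?c = "chart_at Q q"
  have c: "?c \<in> atlas Q" "q \<in> fst ?c" using chart_at_atlas[OF Q q] .
  have "linear (\<lambda>a. fd (action_chart unit_chart ?c) (unit_coord, snd ?c q) (a, 0))"
    by (rule has_derivative_linear[OF partial_derivatives(1)])
       (intro action_chart_differentiable unit_action_dom unit_chart imageI c)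
  then show ?thesis
    by (simp add: components_fundamental_field[OF c, symmetric] components_chart_at[OF Q q])
qed

end

theorem mainTheorem1:
  fixes G :: "('g, 'm) monoid_scheme"
    and GM :: "('g, 'l::real_normed_vector) manifold"
    and Q :: "('q, 'e::real_normed_vector) manifold"
    and \<phi> :: "'g \<Rightarrow> 'q \<Rightarrow> 'q"
    and QG :: "('q set, 'b::real_normed_vector) manifold"
    and \<A> :: "'q \<times> 'e \<Rightarrow> 'l"
    and L :: "'q \<times> 'e \<Rightarrow> real"
    and BB :: "'b set" and EE :: "'l set"
    and I :: "real set"
    and q :: "real \<Rightarrow> 'q" and v :: "real \<Rightarrow> 'e" and p :: "real \<Rightarrow> 'e \<Rightarrow> real"
  defines "Z \<equiv> adapted_frame G GM Q \<phi> QG \<A>"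
  assumes "lie_group G GM" and "connected_space (mtop GM)"
    and "smooth_manifold Q"
    and "smooth_action G GM Q \<phi>" and "free_action G Q \<phi>" and "proper_action GM Q \<phi>"
    and "quotient_manifold G Q \<phi> QG"
    and "smooth_on_tangent_bundle Q L" and "invariant_lagrangian G Q \<phi> L"
    and "principal_connection G GM Q \<phi> \<A>"
    and "is_basis BB" and "is_basis EE"
    and "is_interval I" and "interior I \<noteq> {}"
    and "differentiable_curve Q I q" and "\<And>t. t \<in> I \<Longrightarrow> linear (p t)"
    and "\<And>\<kappa> t. \<lbrakk>\<kappa> \<in> atlas QG; t \<in> I; orbit G \<phi> (q t) \<in> fst \<kappa>\<rbrakk> \<Longrightarrow>
           implicit_euler_lagrange Q L (BB <+> EE) (Z \<kappa>) I q v p t"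
  shows "\<exists>\<mu>. linear \<mu> \<and>
           (\<forall>t\<in>I. \<forall>a\<in>EE. p t (fundamental_field G GM Q \<phi> a (q t)) = \<mu> a) \<and>
           (\<forall>\<kappa>\<in>atlas QG. \<forall>t\<in>I. orbit G \<phi> (q t) \<in> fst \<kappa> \<longrightarrow>
              implicit_lagrange_routh Q L BB EE (Z \<kappa>)
                (\<lambda>i s. representation BB (snd \<kappa> (orbit G \<phi> s)) i) \<mu> I q v p t)"
proof -
  have pb: "principal_bundle G GM Q \<phi> QG \<A>"
    using assms by (simp add: principal_bundle_def)
  then interpret principal_bundle G GM Q \<phi> QG \<A> .
  have qt: "q t \<in> topspace (mtop Q)" if "t \<in> I" for t
    using \<open>differentiable_curve Q I q\<close> that
    by (auto simp: differentiable_curve_def continuous_map_def Pi_iff)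
  have EL: "implicit_euler_lagrange Q L (BB <+> EE) (Z \<kappa>) I q v p t"
    if "\<kappa> \<in> atlas QG" "t \<in> I" "orbit G \<phi> (q t) \<in> fst \<kappa>" for \<kappa> t
    by (rule assms(18)[OF that])
  have fund: "Z \<kappa> (Inr a) = fundamental_field G GM Q \<phi> a" for \<kappa> a
    by (simp add: Z_def adapted_frame_def)
  let ?P = "\<lambda>a t. p t (fundamental_field G GM Q \<phi> a (q t))"
  have zero: "(?P a has_real_derivative 0) (at t within I)" if a: "a \<in> EE" and t: "t \<in> I" for a t
  proof -
    \<comment> \<open>Any chart around the current orbit will do: fundamental fields do not depend
      on \<kappa>, so the equations from different charts concern the same function ?P a on all of
      I.\<close>
    let ?\<kappa> = "chart_at QG (orbit G \<phi> (q t))"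
    have "implicit_euler_lagrange Q L (BB <+> EE) (Z ?\<kappa>) I q v p t"
      using EL chart_at_atlas[OF QG orbit_topspace[OF qt[OF t]]] t by blast
    moreover have "Inr a \<in> BB <+> EE" using a by (rule InrI)
    ultimately have "((\<lambda>s. quasi_momentum (Z ?\<kappa>) (Inr a) (q s) (p s)) has_real_derivative
        complete_lift Q (Z ?\<kappa> (Inr a)) L (q t, v t)) (at t within I)"
      unfolding implicit_euler_lagrange_def by blast
    then have "(?P a has_real_derivative complete_lift Q (fundamental_field G GM Q \<phi> a) L (q t, v t)) (at t within I)"
      by (simp add: quasi_momentum_def fund)
    then show ?thesis
      using complete_lift_fundamental_field[OF \<open>smooth_on_tangent_bundle Q L\<close> \<open>invariant_lagrangian G Q \<phi> L\<close> qt[OF t]]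
      by simp
  qed
  obtain t0 where t0: "t0 \<in> I" using \<open>interior I \<noteq> {}\<close> interior_subset by blast
  \<comment> \<open>Defined on the whole Lie algebra, not only on \<open>EE\<close>, so that
    linearity is inherited from \<open>p t0\<close>.\<close>
  define \<mu> where "\<mu> = (\<lambda>a. ?P a t0)"
  have \<mu>: "linear \<mu>"
    using linear_compose[OF linear_fundamental_field[OF qt[OF t0]] \<open>\<And>t. t \<in> I \<Longrightarrow> linear (p t)\<close>[OF t0]]
    by (simp add: \<mu>_def o_def)
  have momentum: "?P a t = \<mu> a" if a: "a \<in> EE" and t: "t \<in> I" for a t
  proof -
    have "convex I" using \<open>is_interval I\<close> by (rule is_interval_convex)
    then obtain k where "\<forall>t\<in>I. ?P a t = k"
      using has_field_derivative_zero_constant[of I "?P a"] zero[OF a] by blast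
    then show ?thesis using t t0 by (simp add: \<mu>_def)
  qed
  have "implicit_lagrange_routh Q L BB EE (Z \<kappa>)
      (\<lambda>i s. representation BB (snd \<kappa> (orbit G \<phi> s)) i) \<mu> I q v p t"
    if \<kappa>: "\<kappa> \<in> atlas QG" and t: "t \<in> I" and \<pi>q: "orbit G \<phi> (q t) \<in> fst \<kappa>" for \<kappa> t
  proof -
    have "principal_bundle_frame G GM Q \<phi> QG \<A> BB EE \<kappa> (q t)"
      using pb \<open>is_basis BB\<close> \<open>is_basis EE\<close> \<kappa> \<pi>q qt[OF t]
      by (simp add: principal_bundle_frame_def principal_bundle_frame_axioms_def)
    then interpret fr: principal_bundle_frame G GM Q \<phi> QG \<A> BB EE \<kappa> "q t" .
    note V = fr.vertical_lift_routhian[OF \<open>smooth_on_tangent_bundle Q L\<close> \<mu>, folded Z_def]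
    note C = fr.complete_lift_routhian[OF \<open>smooth_on_tangent_bundle Q L\<close> \<mu>, folded Z_def]
    note X = fr.has_derivative_base_coordinate[OF \<open>differentiable_curve Q I q\<close> t refl, folded Z_def]
    have A: "\<A> (q t, Z \<kappa> (Inl i) (q t)) = 0" "\<A> (q t, Z \<kappa> (Inr a) (q t)) = a" for i a
      by (simp_all add: Z_def fr.frame_Inl fr.frame_Inr fr.frame_projection)
    have el: "quasi_velocity (BB <+> EE) (Z \<kappa>) \<alpha> (q t, v t) = quasi_velocity (BB <+> EE) (Z \<kappa>) \<alpha> (q t, velocity Q I q t)"
      "quasi_momentum (Z \<kappa>) \<alpha> (q t) (p t) = vertical_lift Q (Z \<kappa> \<alpha>) L (q t, v t)"
      "((\<lambda>s. quasi_momentum (Z \<kappa>) \<alpha> (q s) (p s)) has_real_derivative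
        complete_lift Q (Z \<kappa> \<alpha>) L (q t, v t)) (at t within I)" if "\<alpha> \<in> BB <+> EE" for \<alpha>
      using EL[OF \<kappa> t \<pi>q] that unfolding implicit_euler_lagrange_def by blast+
    have mom: "quasi_momentum (Z \<kappa>) (Inr a) (q t) (p t) = \<mu> a" if "a \<in> EE" for a
      using momentum[OF that t] by (simp add: quasi_momentum_def fund)
    show ?thesis
      unfolding implicit_lagrange_routh_def Let_def
    proof (intro conjI ballI)
      fix a assume a: "a \<in> EE"
      then have J: "Inr a \<in> BB <+> EE" by (rule InrI)
      show "quasi_velocity (BB <+> EE) (Z \<kappa>) (Inr a) (q t, v t)
          = quasi_velocity (BB <+> EE) (Z \<kappa>) (Inr a) (q t, velocity Q I q t)"
        by (rule el(1)[OF J])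
      \<comment> \<open>By the Euler-Lagrange equations the left side is the momentum minus \<mu> a,
        so this is momentum conservation again.\<close>
      show "vertical_lift Q (Z \<kappa> (Inr a)) (routhian BB EE (Z \<kappa>) L \<mu>) (q t, v t) = 0"
        unfolding V A using el(2)[OF J] mom[OF a] by simp
      show "quasi_momentum (Z \<kappa>) (Inr a) (q t) (p t) = \<mu> a" by (rule mom[OF a])
    next
      fix i assume "i \<in> BB"
      then have J: "Inl i \<in> BB <+> EE" by (rule InlI)
      show vel: "quasi_velocity (BB <+> EE) (Z \<kappa>) (Inl i) (q t, v t)
          = quasi_velocity (BB <+> EE) (Z \<kappa>) (Inl i) (q t, velocity Q I q t)"
        by (rule el(1)[OF J])
      show "((\<lambda>s. representation BB (snd \<kappa> (orbit G \<phi> (q s))) i) has_real_derivative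
          quasi_velocity (BB <+> EE) (Z \<kappa>) (Inl i) (q t, v t)) (at t within I)"
        unfolding vel by (rule X)
      show "vertical_lift Q (Z \<kappa> (Inl i)) (routhian BB EE (Z \<kappa>) L \<mu>) (q t, v t)
          = quasi_momentum (Z \<kappa>) (Inl i) (q t) (p t)"
        unfolding V A using el(2)[OF J] by (simp add: linear_0[OF \<mu>])
      show "((\<lambda>s. quasi_momentum (Z \<kappa>) (Inl i) (q s) (p s)) has_real_derivative
          complete_lift Q (Z \<kappa> (Inl i)) (routhian BB EE (Z \<kappa>) L \<mu>) (q t, v t)
          - (\<Sum>a\<in>EE. \<Sum>j\<in>BB. \<mu> a * curvature_coeff Q EE (Z \<kappa>) a i j (q t)
              * quasi_velocity (BB <+> EE) (Z \<kappa>) (Inl j) (q t, v t))) (at t within I)"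
        unfolding C by (rule el(3)[OF J])
    qed
  qed
  with \<mu> momentum show ?thesis by blast
qed

end
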